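(* Let $G$ be a countably infinite discrete amenable group acting continuously (on the left, by homeomorphisms) on a compact Hausdorff space $X$. Then for every tempered Følner sequence $\{F_n\}_{n\ge 1}$ in $G$, $$h^B_{top}(X,\{F_n\})=h_{top}(X,G),$$ where $h^B_{top}(X,\{F_n\})$ is the Bowen topological entropy (dimensional entropy) of the whole space $X$ with respect to $\{F_n\}$, and $h_{top}(X,G)$ is the topological entropy of $(X,G)$ defined through open covers.
   Context: **Følner sequences.** A Følner sequence in $G$ is a sequence $\{F_n\}_{n\ge1}$ of nonempty finite subsets of $G$ with $\lim_{n\to\infty}\frac{|F_n\vartriangle gF_n|}{|F_n|}=0$ for all $g\in G$. The countable group $G$ is amenable if it has a Følner sequence. The sequence $\{F_n\}$ is *tempered* if there is a constant $C>0$, independent of $n$, such that $\left|\bigcup_{k<n}F_k^{-1}F_n\right|\le C|F_n|$ for every $n$. **Bowen topological entropy (dimensional entropy).** Let $\mathcal U$ be a finite open cover of $X$. For a finite set $F\subset G$, let $\mathcal W_F(\mathcal U)$ be the collection of families $\mathbf U=\{U_g\}_{g\in F}$ with each $U_g\in\mathcal U$. Put $\mathrm{dom}(\mathbf U)=F$, $m(\mathbf U)=|F|$, and $$\mathbf X(\mathbf U)=\bigcap_{g\in F}g^{-1}U_g=\{x\in X: gx\in U_g\text{ for all }g\in F\}.$$ Let $\{F_n\}$ be a Følner sequence. For $Z\subset X$, a collection $\Lambda\subset\bigcup_{n\ge1}\mathcal W_{F_n}(\mathcal U)$ covers $Z$ if $\bigcup_{\mathbf U\in\Lambda}\mathbf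 X(\mathbf U)\supset Z$. For $s\ge0$ and $N\ge1$ define $$\mathcal M(Z,\mathcal U,N,s,\{F_n\})=\inf_{\Lambda}\sum_{\mathbf U\in\Lambda}\exp(-s\,m(\mathbf U)),$$ the infimum being over all $\Lambda\subset\bigcup_{j\ge N}\mathcal W_{F_j}(\mathcal U)$ that cover $Z$. This is nondecreasing in $N$; set $$\mathcal M(Z,\mathcal U,s,\{F_n\})=\lim_{N\to\infty}\mathcal M(Z,\mathcal U,N,s,\{F_n\}),$$ $$h^B_{top}(\mathcal U,Z,\{F_n\})=\inf\{s\ge0:\mathcal M(Z,\mathcal U,s,\{F_n\})=0\},$$ $$h^B_{top}(Z,\{F_n\})=\sup_{\mathcal U}h^B_{top}(\mathcal U,Z,\{F_n\}),$$ where $\mathcal U$ runs over all finite open covers of $X$. **Topological entropy.** For a finite open cover $\mathcal U$ of $X$ and a finite nonempty $F\subset G$, let $\mathcal U^F=\bigvee_{g\in F}g^{-1}\mathcal U=\{\mathbf X(\mathbf U):\mathbf U\in\mathcal W_F(\mathcal U)\}$, and let $N(\mathcal U^F)$ be the minimal cardinality of a subcover of $\mathcal U^F$. Then $$h_{top}(G,\mathcal U)=\lim_{n\to\infty}\frac1{|F_n|}\log N(\mathcal U^{F_n}),\qquad h_{top}(X,G)=\sup_{\mathcal U}h_{top}(G,\mathcal U),$$ where $\log$ is the natural logarithm and the supremum is over all finite open covers of $X$. It is a standard fact (Ornstein–Weiss) that the limit exists and does not depend on the choice of Følner sequence $\{F_n\}$. Entropies take values in $[0,+\infty]$. *)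

theory Defs
  imports "HOL-Analysis.Analysis" "HOL-Algebra.Group_Action"
begin

text \<open>
  Sequences \<open>(F\<^sub>n)\<close> are indexed from \<open>n = 0\<close> instead of \<open>n = 1\<close> throughout.
\<close>

definition folner_sequence :: "('g, 'm) monoid_scheme \<Rightarrow> (nat \<Rightarrow> 'g set) \<Rightarrow> bool" where
  "folner_sequence G F \<longleftrightarrow>
     (\<forall>n. F n \<noteq> {} \<and> finite (F n) \<and> F n \<subseteq> carrier G) \<and>
     (\<forall>g \<in> carrier G.
        (\<lambda>n. real (card (sym_diff (F n) (g <#\<^bsub>G\<^esub> F n))) / real (card (F n))) \<longlonglongrightarrow> 0)"

definition amenable :: "('g, 'm) monoid_scheme \<Rightarrow> bool" where
  "amenable G \<longleftrightarrow> (\<exists>F. folner_sequence G F)"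

definition tempered :: "('g, 'm) monoid_scheme \<Rightarrow> (nat \<Rightarrow> 'g set) \<Rightarrow> bool" where
  "tempered G F \<longleftrightarrow>
     (\<exists>C > 0. \<forall>n. real (card (\<Union>k<n. (set_inv\<^bsub>G\<^esub> (F k)) <#>\<^bsub>G\<^esub> F n)) \<le> C * real (card (F n)))"

definition acts_by_homeomorphisms ::
    "('g, 'm) monoid_scheme \<Rightarrow> 'x topology \<Rightarrow> ('g \<Rightarrow> 'x \<Rightarrow> 'x) \<Rightarrow> bool" where
  "acts_by_homeomorphisms G X \<phi> \<longleftrightarrow>
     group_action G (topspace X) \<phi> \<and> (\<forall>g \<in> carrier G. homeomorphic_map X X (\<phi> g))"

definition finite_open_cover :: "'x topology \<Rightarrow> 'x set set \<Rightarrow> bool" where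
  "finite_open_cover X \<U> \<longleftrightarrow> finite \<U> \<and> (\<forall>U \<in> \<U>. openin X U) \<and> \<Union>\<U> = topspace X"

text \<open>
  A family \<open>(U\<^sub>g)\<close> indexed by \<open>g \<in> F\<close> is a partial map with domain \<open>F\<close>, so that it
  determines its index set and its length \<open>card (dom u)\<close>.
\<close>

definition words :: "'x set set \<Rightarrow> 'g set \<Rightarrow> ('g \<rightharpoonup> 'x set) set" where
  "words \<U> F = {u. dom u = F \<and> ran u \<subseteq> \<U>}"

definition word_set :: "'x topology \<Rightarrow> ('g \<Rightarrow> 'x \<Rightarrow> 'x) \<Rightarrow> ('g \<rightharpoonup> 'x set) \<Rightarrow> 'x set" where
  "word_set X \<phi> u = {x \<in> topspace X. \<forall>g \<in> dom u. \<phi> g x \<in> the (u g)}"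


subsection \<open>Bowen topological entropy\<close>

text \<open>\<open>bowen_premeasure\<close> is \<open>M(Z, \<U>, N, s, (F\<^sub>n))\<close> and \<open>bowen_measure\<close> its limit
  \<open>M(Z, \<U>, s, (F\<^sub>n))\<close> as \<open>N\<close> tends to infinity; both take values in \<open>[0, \<infinity>]\<close>.\<close>

definition bowen_premeasure ::
    "'x topology \<Rightarrow> ('g \<Rightarrow> 'x \<Rightarrow> 'x) \<Rightarrow> (nat \<Rightarrow> 'g set) \<Rightarrow> 'x set set \<Rightarrow> 'x set \<Rightarrow> real \<Rightarrow> nat \<Rightarrow> ennreal" where
  "bowen_premeasure X \<phi> F \<U> Z s N =
     (INF \<Lambda> \<in> {\<Lambda>. \<Lambda> \<subseteq> (\<Union>j\<in>{N..}. words \<U> (F j)) \<and> Z \<subseteq> (\<Union>u\<in>\<Lambda>. word_set X \<phi> u)}.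
        infsum (\<lambda>u. ennreal (exp (- s * real (card (dom u))))) \<Lambda>)"

definition bowen_measure ::
    "'x topology \<Rightarrow> ('g \<Rightarrow> 'x \<Rightarrow> 'x) \<Rightarrow> (nat \<Rightarrow> 'g set) \<Rightarrow> 'x set set \<Rightarrow> 'x set \<Rightarrow> real \<Rightarrow> ennreal" where
  "bowen_measure X \<phi> F \<U> Z s = lim (bowen_premeasure X \<phi> F \<U> Z s)"

definition bowen_entropy_cover ::
    "'x topology \<Rightarrow> ('g \<Rightarrow> 'x \<Rightarrow> 'x) \<Rightarrow> (nat \<Rightarrow> 'g set) \<Rightarrow> 'x set set \<Rightarrow> 'x set \<Rightarrow> ereal" where
  "bowen_entropy_cover X \<phi> F \<U> Z = Inf {ereal s | s. 0 \<le> s \<and> bowen_measure X \<phi> F \<U> Z s = 0}"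

definition bowen_entropy ::
    "'x topology \<Rightarrow> ('g \<Rightarrow> 'x \<Rightarrow> 'x) \<Rightarrow> (nat \<Rightarrow> 'g set) \<Rightarrow> 'x set \<Rightarrow> ereal" where
  "bowen_entropy X \<phi> F Z = (SUP \<U> \<in> {\<U>. finite_open_cover X \<U>}. bowen_entropy_cover X \<phi> F \<U> Z)"


subsection \<open>Topological entropy\<close>

definition iterated_cover ::
    "'x topology \<Rightarrow> ('g \<Rightarrow> 'x \<Rightarrow> 'x) \<Rightarrow> 'x set set \<Rightarrow> 'g set \<Rightarrow> 'x set set" where
  "iterated_cover X \<phi> \<U> F = word_set X \<phi> ` words \<U> F"

definition cover_number :: "'x topology \<Rightarrow> 'x set set \<Rightarrow> nat" where
  "cover_number X \<V> =
     (LEAST k. \<exists>\<W>. \<W> \<subseteq> \<V> \<and> finite \<W> \<and> topspace X \<subseteq> \<Union>\<W> \<and> card \<W> = k)"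

text \<open>
  The entropy of a cover is the common limit along all Folner sequences; for an amenable
  group it exists by the Ornstein--Weiss lemma. If \<open>X\<close> is empty, the cover numbers are \<open>0\<close>
  and the convention \<open>ln 0 = 0\<close> gives entropy \<open>0\<close>.
\<close>

definition top_entropy_cover ::
    "('g, 'm) monoid_scheme \<Rightarrow> 'x topology \<Rightarrow> ('g \<Rightarrow> 'x \<Rightarrow> 'x) \<Rightarrow> 'x set set \<Rightarrow> real" where
  "top_entropy_cover G X \<phi> \<U> =
     (THE h. \<forall>F. folner_sequence G F \<longrightarrow>
        (\<lambda>n. ln (real (cover_number X (iterated_cover X \<phi> \<U> (F n)))) / real (card (F n)))
          \<longlonglongrightarrow> h)"

definition top_entropy ::
    "('g, 'm) monoid_scheme \<Rightarrow> 'x topology \<Rightarrow> ('g \<Rightarrow> 'x \<Rightarrow> 'x) \<Rightarrow> ereal" where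
  "top_entropy G X \<phi> = (SUP \<U> \<in> {\<U>. finite_open_cover X \<U>}. ereal (top_entropy_cover G X \<phi> \<U>))"

end

theory Submission
  imports Defs
begin

text \<open>
  Write \<open>r(E) = ln N(\<U>\<^sup>E) / |E|\<close>. A minimal subcover of \<open>\<U>\<^bsup>F n\<^esup>\<close> is an admissible cover in the
  definition of the Bowen entropy, which gives \<open>h\<^sup>B(\<U>, F) \<le> lim inf r(F n)\<close>.

  Conversely let \<open>M(X, \<U>, s, F) = 0\<close> with \<open>F\<close> tempered. By compactness there are finite families
  \<open>\<Lambda>\<^sub>0, \<dots>, \<Lambda>\<^bsub>K-1\<^esub>\<close> of words, each covering \<open>X\<close> with total weight at most \<open>\<gamma>\<close>, such that the index
  sets of \<open>\<Lambda>\<^sub>i\<^sub>+\<^sub>1\<close> are very invariant under those of \<open>\<Lambda>\<^sub>i\<close>. Given a very invariant set \<open>E\<close> and a point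
  \<open>x\<close>, every \<open>c \<in> E\<close> selects for each \<open>i\<close> a word of \<open>\<Lambda>\<^sub>i\<close> containing \<open>c x\<close>, hence a tile \<open>F j #> c\<close>. A
  Vitali argument using temperedness, applied from level \<open>K - 1\<close> down to level \<open>0\<close> to what is
  still uncovered, selects almost disjoint tiles that cover almost all of \<open>E\<close>. The chosen centres
  and words determine the itinerary of \<open>x\<close> on the tiles. Since the sum over all sets \<open>P\<close> of pairs
  (centre, word) of the product of the weights is at most \<open>exp (K \<gamma> |E|)\<close>, there are at most about
  \<open>exp (s |E|)\<close> relevant sets \<open>P\<close>. Hence \<open>lim sup r(E n) \<le> h\<^sup>B(\<U>, F)\<close> for every Folner sequence \<open>E\<close>.

  Applying this to tempered subsequences of \<open>E\<close> that realise \<open>lim inf r(E n)\<close> shows that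
  \<open>r(E n)\<close> converges to \<open>h\<^sup>B(\<U>, F)\<close> for every \<open>E\<close>, so the Ornstein--Weiss lemma need not be assumed.
\<close>

section \<open>Tilings by tempered sequences\<close>

text \<open>Elements are processed in order of decreasing \<open>j\<close>, so an element is only ever rejected because
  of selected tiles of at least its own level.\<close>

lemma greedy_selection:
  fixes T :: "'a \<Rightarrow> 'b set" and j :: "'a \<Rightarrow> nat"
  assumes "finite A" and fin: "\<And>c. c \<in> A \<Longrightarrow> finite (T c)" and e: "0 < \<epsilon>" "\<epsilon> < 1"
  shows "\<exists>D\<subseteq>A. (1 - \<epsilon>) * (\<Sum>c\<in>D. real (card (T c))) \<le> real (card (\<Union>(T ` D))) \<and>
    (\<forall>c\<in>A. \<epsilon> * real (card (T c)) \<le> real (card (T c \<inter> \<Union>(T ` {d \<in> D. j c \<le> j d}))))"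
  using \<open>finite A\<close> fin
\<comment> \<open>The sign makes the induction add elements of high level first, so a newly added
  \<open>x\<close> has least level so far.\<close>
proof (induction A rule: finite_ranking_induct[where f = "\<lambda>c. - int (j c)"])
  case empty
  then show ?case by simp
next
  case (insert x A)
  then obtain D where D: "D \<subseteq> A"
    "(1 - \<epsilon>) * (\<Sum>c\<in>D. real (card (T c))) \<le> real (card (\<Union>(T ` D)))"
    "\<And>c. c \<in> A \<Longrightarrow> \<epsilon> * real (card (T c)) \<le> real (card (T c \<inter> \<Union>(T ` {d \<in> D. j c \<le> j d})))"
    by blast
  have finD: "finite D" using D(1) insert.hyps finite_subset by blast
  have finT: "finite (\<Union>(T ` D))" using finD D(1) insert.prems by auto
  have min: "{d \<in> D. j x \<le> j d} = D" using insert.hyps(2) D(1) by fastforce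
  show ?case
  proof (cases "\<epsilon> * real (card (T x)) \<le> real (card (T x \<inter> \<Union>(T ` D)))")
    case True
    then have "\<forall>c\<in>insert x A.
        \<epsilon> * real (card (T c)) \<le> real (card (T c \<inter> \<Union>(T ` {d \<in> D. j c \<le> j d})))"
      using D(3) by (simp add: min)
    then show ?thesis using D(1,2) by blast
  next
    case False
    have Tx: "finite (T x)" using insert.prems by simp
    have xD: "x \<notin> D"
    proof
      assume "x \<in> D"
      then have "T x \<inter> \<Union>(T ` D) = T x" by blast
      then show False using False e mult_right_mono[of \<epsilon> 1 "real (card (T x))"] by simp
    qed
    \<comment> \<open>Less than a fraction \<epsilon> of \<open>T x\<close> is covered so far, so
      accepting \<open>x\<close> adds more than \<open>(1 - \<epsilon>) * card (T x)\<close> new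
      points.\<close>
    have "card (\<Union>(T ` insert x D)) = card (\<Union>(T ` D)) + card (T x - \<Union>(T ` D))"
      using card_Un_disjoint[of "\<Union>(T ` D)" "T x - \<Union>(T ` D)"] finT Tx
      by (simp add: Un_commute)
    moreover have "card (T x) = card (T x \<inter> \<Union>(T ` D)) + card (T x - \<Union>(T ` D))"
      using card_Int_Diff Tx by blast
    ultimately have "(1 - \<epsilon>) * (\<Sum>c\<in>insert x D. real (card (T c))) \<le> real (card (\<Union>(T ` insert x D)))"
      using D(2) False finD xD by (simp add: algebra_simps)
    moreover have "\<epsilon> * real (card (T c)) \<le>
        real (card (T c \<inter> \<Union>(T ` {d \<in> insert x D. j c \<le> j d})))" if c: "c \<in> insert x A" for c
    proof (cases "c = x")
      case True
      then have "T c \<inter> \<Union>(T ` {d \<in> insert x D. j c \<le> j d}) = T c" by blast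
      then show ?thesis using e mult_right_mono[of \<epsilon> 1 "real (card (T c))"] by simp
    next
      case False
      then have "c \<in> A" using c by simp
      then have "finite (T c)" using insert.prems by simp
      then have "card (T c \<inter> \<Union>(T ` {d \<in> D. j c \<le> j d}))
          \<le> card (T c \<inter> \<Union>(T ` {d \<in> insert x D. j c \<le> j d}))"
        by (intro card_mono) auto
      then show ?thesis using D(3)[OF \<open>c \<in> A\<close>] by linarith
    qed
    ultimately show ?thesis using D(1) by (intro exI[of _ "insert x D"]) blast
  qed
qed

section \<open>Right translates of finite sets as tiles\<close>

context group
begin

lemma card_r_coset: "H \<subseteq> carrier G \<Longrightarrow> c \<in> carrier G \<Longrightarrow> card (H #> c) = card H"
proof -
  assume H: "H \<subseteq> carrier G" "c \<in> carrier G"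
  have "H #> c = (\<lambda>h. h \<otimes> c) ` H" by (auto simp: r_coset_def)
  moreover have "inj_on (\<lambda>h. h \<otimes> c) H" using H by (meson inj_onI right_cancel subsetD)
  ultimately show ?thesis by (simp add: card_image)
qed

lemma finite_r_coset: "finite H \<Longrightarrow> finite (H #> c)"
  by (simp add: r_coset_def)

text \<open>A common point \<open>h \<otimes> c = k \<otimes> d\<close> gives
  \<open>c = (inv h \<otimes> k) \<otimes> d\<close>. This turns the meeting of two tiles into a
  constraint on centres, of the kind that temperedness and invariance can count.\<close>

lemma r_coset_meet:
  assumes "H \<subseteq> carrier G" "K \<subseteq> carrier G" "c \<in> carrier G" "d \<in> carrier G"
    and "(H #> c) \<inter> (K #> d) \<noteq> {}"
  shows "c \<in> (set_inv H <#> K) #> d"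
proof -
  obtain h k where hk: "h \<in> H" "k \<in> K" "h \<otimes> c = k \<otimes> d"
    using assms(5) by (auto simp: r_coset_def)
  have "c = inv h \<otimes> (h \<otimes> c)"
    using assms hk(1) by (simp add: m_assoc[symmetric] subset_eq)
  also have "\<dots> = (inv h \<otimes> k) \<otimes> d"
    using assms hk by (simp add: m_assoc subset_eq)
  finally show ?thesis using hk
    by (auto simp: r_coset_def set_mult_def SET_INV_def)
qed

lemma set_mult_inv_subset:
  "H \<subseteq> carrier G \<Longrightarrow> K \<subseteq> carrier G \<Longrightarrow> set_inv H <#> K \<subseteq> carrier G"
  by (auto simp: set_mult_def SET_INV_def)

lemma finite_set_mult: "finite H \<Longrightarrow> finite K \<Longrightarrow> finite (H <#> K)"
  by (simp add: set_mult_def)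

lemma finite_set_inv: "finite H \<Longrightarrow> finite (set_inv H)"
  by (simp add: SET_INV_def)

text \<open>
  Temperedness bounds the centres whose tile meets a selected tile of strictly higher level. It says
  nothing about \<open>F\<^sub>n\<^sup>-\<^sup>1 F\<^sub>n\<close>, so centres meeting only tiles of their own level are counted
  by double counting instead, which is why the tiles are only \<open>\<epsilon>\<close>-disjoint.
\<close>

lemma tempered_vitali:
  fixes F :: "nat \<Rightarrow> 'a set" and j :: "'a \<Rightarrow> nat"
  assumes F: "\<And>n. finite (F n)" "\<And>n. F n \<noteq> {}" "\<And>n. F n \<subseteq> carrier G"
    and temp: "\<And>n. real (card (\<Union>k<n. set_inv (F k) <#> F n)) \<le> C * real (card (F n))"
    and C: "C \<ge> 0" and e: "0 < \<epsilon>" "\<epsilon> < 1"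
    and A: "finite A" "A \<subseteq> carrier G"
  obtains D where "D \<subseteq> A"
    "(1 - \<epsilon>) * (\<Sum>c\<in>D. real (card (F (j c)))) \<le> real (card (\<Union>c\<in>D. F (j c) #> c))"
    "real (card A) \<le> (C / (1 - \<epsilon>) + 1 / \<epsilon>) * real (card (\<Union>c\<in>D. F (j c) #> c))"
proof -
  define T where "T c = F (j c) #> c" for c
  have finT: "finite (T c)" for c by (simp add: T_def F finite_r_coset)
  have cardT: "card (T c) = card (F (j c))" if "c \<in> A" for c
    using that A F card_r_coset by (auto simp: T_def)
  obtain D where D: "D \<subseteq> A"
    "(1 - \<epsilon>) * (\<Sum>c\<in>D. real (card (T c))) \<le> real (card (\<Union>(T ` D)))"
    "\<And>c. c \<in> A \<Longrightarrow> \<epsilon> * real (card (T c)) \<le> real (card (T c \<inter> \<Union>(T ` {d \<in> D. j c \<le> j d})))"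
    using greedy_selection[where j = j and T = T, OF A(1) finT e] by blast
  have sumT: "(\<Sum>c\<in>D. real (card (T c))) = (\<Sum>c\<in>D. real (card (F (j c))))"
    using D(1) cardT by (intro sum.cong) auto
  have finD: "finite D" using D(1) A(1) finite_subset by blast
  define S where "S = \<Union>(T ` D)"
  have finS: "finite S" using finD finT by (simp add: S_def)
  define B where "B = {c \<in> A. \<exists>d\<in>D. j c < j d \<and> T c \<inter> T d \<noteq> {}}"
  \<comment> \<open>Since \<open>j c < j d\<close>, the set \<open>F (j c)\<close> is one of those
    in the tempered union of level \<open>j d\<close>, so the centre \<open>c\<close> lies in the
    translate of that union by \<open>d\<close>.\<close>
  have "B \<subseteq> (\<Union>d\<in>D. (\<Union>k<j d. set_inv (F k) <#> F (j d)) #> d)"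
  proof
    fix c assume "c \<in> B"
    then obtain d where d: "c \<in> A" "d \<in> D" "j c < j d" "T c \<inter> T d \<noteq> {}" by (auto simp: B_def)
    then have "c \<in> (set_inv (F (j c)) <#> F (j d)) #> d"
      using r_coset_meet[of "F (j c)" "F (j d)" c d] F(3) subsetD[OF A(2)] subsetD[OF D(1)]
      by (simp add: T_def)
    then show "c \<in> (\<Union>d\<in>D. (\<Union>k<j d. set_inv (F k) <#> F (j d)) #> d)"
      using d by (auto simp: r_coset_def)
  qed
  then have "card B \<le> card (\<Union>d\<in>D. (\<Union>k<j d. set_inv (F k) <#> F (j d)) #> d)"
    by (intro card_mono) (auto simp: finD F intro!: finite_r_coset finite_set_mult finite_set_inv)
  also have "\<dots> \<le> (\<Sum>d\<in>D. card ((\<Union>k<j d. set_inv (F k) <#> F (j d)) #> d))"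
    by (rule card_UN_le[OF finD])
  also have "\<dots> = (\<Sum>d\<in>D. card (\<Union>k<j d. set_inv (F k) <#> F (j d)))"
  proof (intro sum.cong refl card_r_coset)
    fix d assume "d \<in> D"
    then show "d \<in> carrier G" using D(1) A by auto
    show "(\<Union>k<j d. set_inv (F k) <#> F (j d)) \<subseteq> carrier G"
      using set_mult_inv_subset[OF F(3) F(3)] by blast
  qed
  finally have "real (card B) \<le> (\<Sum>d\<in>D. real (card (\<Union>k<j d. set_inv (F k) <#> F (j d))))"
    by (simp flip: of_nat_sum)
  also have "\<dots> \<le> (\<Sum>d\<in>D. C * real (card (F (j d))))" by (intro sum_mono temp)
  also have "\<dots> = C / (1 - \<epsilon>) * ((1 - \<epsilon>) * (\<Sum>d\<in>D. real (card (F (j d)))))"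
    using e by (simp add: sum_distrib_left)
  also have "\<dots> \<le> C / (1 - \<epsilon>) * real (card S)"
    using D(2) C e by (intro mult_left_mono) (auto simp: S_def sumT)
  finally have B: "real (card B) \<le> C / (1 - \<epsilon>) * real (card S)" .
  \<comment> \<open>A point lies in \<open>Q c\<close> when the highest selected tile through it has
    the level of \<open>c\<close>. Outside \<open>B\<close> no higher selected tile meets
    \<open>T c\<close>, so the part of \<open>T c\<close> covered at level \<open>j c\<close> or
    above lies in \<open>Q c\<close>. All \<open>c\<close> whose \<open>Q c\<close> contains a given
    point share one level, which makes the double count below possible.\<close>
  define Q where "Q c = {g \<in> T c. (\<exists>d\<in>D. g \<in> T d \<and> j d = j c) \<and> (\<forall>d\<in>D. g \<in> T d \<longrightarrow> j d \<le> j c)}" for c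
  have rest: "\<epsilon> \<le> real (card (Q c)) / real (card (F (j c)))" if c: "c \<in> A - B" for c
  proof -
    have "T c \<inter> \<Union>(T ` {d \<in> D. j c \<le> j d}) \<subseteq> Q c"
    proof
      fix g assume g: "g \<in> T c \<inter> \<Union>(T ` {d \<in> D. j c \<le> j d})"
      then have "j d \<le> j c" if "d \<in> D" "g \<in> T d" for d
        using c that by (auto simp: B_def not_le[symmetric])
      then show "g \<in> Q c" using g by (fastforce simp: Q_def)
    qed
    then have "card (T c \<inter> \<Union>(T ` {d \<in> D. j c \<le> j d})) \<le> card (Q c)"
      by (intro card_mono) (simp_all add: Q_def finT)
    then have "\<epsilon> * real (card (F (j c))) \<le> real (card (Q c))"
      using D(3)[of c] cardT[of c] c by auto
    moreover have "card (F (j c)) > 0" using F by (simp add: card_gt_0_iff)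
    ultimately show ?thesis by (simp add: field_simps)
  qed
  \<comment> \<open>If the common level is \<open>n\<close>, these centres lie among the
    \<open>inv f \<otimes> g\<close> with \<open>f \<in> F n\<close>. Hence there are at most
    \<open>card (F n)\<close> of them, each of weight \<open>1 / card (F n)\<close>.\<close>
  have one: "(\<Sum>c\<in>{c \<in> A - B. g \<in> Q c}. 1 / real (card (F (j c)))) \<le> 1" if g: "g \<in> S" for g
  proof (cases "{c \<in> A - B. g \<in> Q c} = {}")
    case True
    then show ?thesis by (metis sum.empty zero_le_one)
  next
    case False
    then obtain b where b: "b \<in> A - B" "g \<in> Q b" by blast
    have lev: "j c = j b" if c: "c \<in> A - B" "g \<in> Q c" for c
    proof -
      from c obtain d where d: "d \<in> D" "g \<in> T d" "j d = j c" by (auto simp: Q_def)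
      from b obtain d' where d': "d' \<in> D" "g \<in> T d'" "j d' = j b" by (auto simp: Q_def)
      from b c d d' have "j d \<le> j b" "j d' \<le> j c" unfolding Q_def by blast+
      with d d' show ?thesis by simp
    qed
    have gG: "g \<in> carrier G" using b r_coset_subset_G[OF F(3), of b "j b"] A by (auto simp: Q_def T_def)
    have "{c \<in> A - B. g \<in> Q c} \<subseteq> (\<lambda>f. inv f \<otimes> g) ` F (j b)"
    proof
      fix c assume "c \<in> {c \<in> A - B. g \<in> Q c}"
      then have c: "c \<in> carrier G" "j c = j b" "g \<in> T c" using lev A by (auto simp: Q_def)
      then obtain f where f: "f \<in> F (j b)" "g = f \<otimes> c" by (auto simp: T_def r_coset_def)
      then have "c = inv f \<otimes> g" using F(3)[of "j b"] c by (metis inv_solve_left m_closed subsetD)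
      then show "c \<in> (\<lambda>f. inv f \<otimes> g) ` F (j b)" using f by blast
    qed
    then have "card {c \<in> A - B. g \<in> Q c} \<le> card (F (j b))"
      using surj_card_le[OF F(1)] by blast
    moreover have "(\<Sum>c\<in>{c \<in> A - B. g \<in> Q c}. 1 / real (card (F (j c))))
        = real (card {c \<in> A - B. g \<in> Q c}) / real (card (F (j b)))"
    proof -
      have "(\<Sum>c\<in>{c \<in> A - B. g \<in> Q c}. 1 / real (card (F (j c))))
          = (\<Sum>c\<in>{c \<in> A - B. g \<in> Q c}. 1 / real (card (F (j b))))"
        using lev by (intro sum.cong refl) auto
      then show ?thesis by simp
    qed
    ultimately show ?thesis by (auto simp: divide_le_eq_1)
  qed
  have finAB: "finite (A - B)" using A by simp
  have "\<epsilon> * real (card (A - B)) \<le> (\<Sum>c\<in>A - B. real (card (Q c)) / real (card (F (j c))))"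
    using sum_mono[of "A - B" "\<lambda>_. \<epsilon>", OF rest] by (simp add: mult.commute)
  also have "\<dots> = (\<Sum>c\<in>A - B. \<Sum>g\<in>{g \<in> S. g \<in> Q c}. 1 / real (card (F (j c))))"
  proof (intro sum.cong refl)
    fix c
    have "{g \<in> S. g \<in> Q c} = Q c" by (auto simp: Q_def S_def)
    then show "real (card (Q c)) / real (card (F (j c))) = (\<Sum>g\<in>{g \<in> S. g \<in> Q c}. 1 / real (card (F (j c))))"
      by simp
  qed
  also have "\<dots> = (\<Sum>g\<in>S. \<Sum>c\<in>{c \<in> A - B. g \<in> Q c}. 1 / real (card (F (j c))))"
    by (rule sum.swap_restrict[OF finAB finS])
  also have "\<dots> \<le> (\<Sum>g\<in>S. 1)" by (intro sum_mono one)
  finally have AB: "real (card (A - B)) \<le> 1 / \<epsilon> * real (card S)"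
    using e by (simp add: field_simps)
  have "card A = card B + card (A - B)"
    using card_Int_Diff[OF A(1), of B] by (simp add: B_def Int_def conj_commute)
  then have "real (card A) \<le> (C / (1 - \<epsilon>) + 1 / \<epsilon>) * real (card S)"
    using B AB by (simp add: algebra_simps)
  then show ?thesis
    using that[OF D(1)] D(2)[unfolded sumT] unfolding S_def T_def by blast
qed

text \<open>Level \<open>n\<close> tiles what levels \<open>n + 1, \<dots>, K - 1\<close> have left
  uncovered. A point of this rest can serve as a centre unless its tile leaves \<open>E\<close> or
  meets a tile chosen before; both exceptions are boundary effects, of total size at most
  \<open>\<rho> * card E\<close>. Here \<eta> is the reciprocal of the constant in
  \<open>tempered_vitali\<close>, so each level covers a number of points at least \<eta> times the
  number of usable centres, and the rest decays geometrically towards \<rho>.\<close>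

lemma multilevel_tiling:
  fixes F :: "nat \<Rightarrow> 'a set" and j :: "nat \<Rightarrow> 'a \<Rightarrow> nat" and J :: "nat \<Rightarrow> nat set"
  defines "T \<equiv> \<lambda>p. F (j (fst p) (snd p)) #> snd p"
    and "l \<equiv> \<lambda>p. real (card (F (j (fst p) (snd p))))"
  assumes F: "\<And>n. finite (F n)" "\<And>n. F n \<noteq> {}" "\<And>n. F n \<subseteq> carrier G"
    and temp: "\<And>n. real (card (\<Union>k<n. set_inv (F k) <#> F n)) \<le> C * real (card (F n))"
    and C: "C \<ge> 0" and e: "0 < \<epsilon>" "\<epsilon> < 1" and d: "\<delta> \<ge> 0"
    and E: "finite E" "E \<subseteq> carrier G"
    and J: "\<And>i. finite (J i)" "\<And>i c. i < K \<Longrightarrow> c \<in> E \<Longrightarrow> j i c \<in> J i"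
    and inv: "\<And>i i' m. i < i' \<Longrightarrow> i' < K \<Longrightarrow> m \<in> J i' \<Longrightarrow>
      real (card ((set_inv (\<Union>k\<in>J i. F k) <#> F m) - F m)) \<le> \<delta> * real (card (F m))"
    and Einv: "\<And>i. i < K \<Longrightarrow>
      real (card {c \<in> E. \<not> (\<Union>k\<in>J i. F k) #> c \<subseteq> E}) \<le> \<delta> * real (card E)"
    and eta: "\<eta> = 1 / (C / (1 - \<epsilon>) + 1 / \<epsilon>)" and rho: "\<rho> = \<delta> + \<delta> / (1 - \<epsilon>)"
  obtains D where "D \<subseteq> {..<K} \<times> E" "\<Union>(T ` D) \<subseteq> E"
    "(1 - \<epsilon>) * sum l D \<le> real (card (\<Union>(T ` D)))"
    "real (card (E - \<Union>(T ` D))) \<le> ((1 - \<eta>) ^ K + \<rho>) * real (card E)"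
proof -
  have pos: "C / (1 - \<epsilon>) \<ge> 0" "1 / \<epsilon> \<ge> 1" using C e by auto
  then have eta01: "0 < \<eta>" "\<eta> \<le> 1" by (auto simp: eta divide_le_eq_1)
  have rho0: "\<rho> \<ge> 0" using d e by (simp add: rho)
  have finT: "finite (T p)" for p by (simp add: T_def F finite_r_coset)
  have "\<exists>D\<subseteq>{0..<K} \<times> E. \<Union>(T ` D) \<subseteq> E \<and> (1 - \<epsilon>) * sum l D \<le> real (card (\<Union>(T ` D))) \<and>
    real (card (E - \<Union>(T ` D))) \<le> ((1 - \<eta>) ^ (K - 0) + \<rho>) * real (card E)"
  proof (rule inc_induct[of 0 K])
    show "\<exists>D\<subseteq>{K..<K} \<times> E. \<Union>(T ` D) \<subseteq> E \<and> (1 - \<epsilon>) * sum l D \<le> real (card (\<Union>(T ` D))) \<and>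
        real (card (E - \<Union>(T ` D))) \<le> ((1 - \<eta>) ^ (K - K) + \<rho>) * real (card E)"
      using rho0 mult_right_mono[of 1 "1 + \<rho>" "real (card E)"] by auto
  next
    fix n assume n: "n < K"
    assume "\<exists>D\<subseteq>{Suc n..<K} \<times> E. \<Union>(T ` D) \<subseteq> E \<and> (1 - \<epsilon>) * sum l D \<le> real (card (\<Union>(T ` D))) \<and>
        real (card (E - \<Union>(T ` D))) \<le> ((1 - \<eta>) ^ (K - Suc n) + \<rho>) * real (card E)"
    then obtain D where D: "D \<subseteq> {Suc n..<K} \<times> E" "\<Union>(T ` D) \<subseteq> E"
        "(1 - \<epsilon>) * sum l D \<le> real (card (\<Union>(T ` D)))"
        "real (card (E - \<Union>(T ` D))) \<le> ((1 - \<eta>) ^ (K - Suc n) + \<rho>) * real (card E)"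
      by blast
    define S where "S = \<Union>(T ` D)"
    define I where "I = (\<Union>k\<in>J n. F k)"
    have I: "finite I" "I \<subseteq> carrier G" using J(1) F(1,3) unfolding I_def by blast+
    have finD: "finite D" using D(1) E(1) by (meson finite_SigmaI finite_atLeastLessThan finite_subset)
    have finS: "finite S" using D(2) E(1) finite_subset by (auto simp: S_def)
    define A where "A = {c \<in> E. F (j n c) #> c \<subseteq> E - S}"
    have A: "finite A" "A \<subseteq> carrier G" using E by (auto simp: A_def)
    define bad where "bad = {c \<in> E. \<not> I #> c \<subseteq> E}"
    \<comment> \<open>A centre in the rest lies outside \<open>S\<close>, in particular outside
      \<open>T p\<close>. So if its tile meets \<open>T p\<close>, it lies in the outer boundary of
      \<open>T p\<close> under \<open>set_inv I\<close>, which \<open>inv\<close> bounds because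
      \<open>p\<close> has a higher level.\<close>
    define near where "near p = ((set_inv I <#> F (j (fst p) (snd p))) - F (j (fst p) (snd p))) #> snd p" for p
    have sub: "E - S \<subseteq> A \<union> bad \<union> \<Union>(near ` D)"
    proof
      fix c assume c: "c \<in> E - S"
      have FI: "F (j n c) \<subseteq> I" using J(2)[OF n, of c] c by (auto simp: I_def)
      show "c \<in> A \<union> bad \<union> \<Union>(near ` D)"
      proof (cases "c \<in> A \<or> c \<in> bad")
        case False
        then have "I #> c \<subseteq> E" "\<not> F (j n c) #> c \<subseteq> E - S" using c by (auto simp: A_def bad_def)
        moreover have "F (j n c) #> c \<subseteq> I #> c" using FI by (auto simp: r_coset_def)
        ultimately obtain p where p: "p \<in> D" "(F (j n c) #> c) \<inter> T p \<noteq> {}"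
          unfolding S_def by blast
        obtain i a where ia: "p = (i, a)" by (cases p)
        have ac: "a \<in> carrier G" "c \<in> carrier G" using p(1) D(1) ia E(2) c by auto
        have "(F (j n c) #> c) \<inter> (F (j i a) #> a) \<noteq> {}" using p ia by (simp add: T_def)
        then have "c \<in> (set_inv (F (j n c)) <#> F (j i a)) #> a"
          using r_coset_meet F(3) ac by blast
        then have "c \<in> (set_inv I <#> F (j i a)) #> a"
          using FI by (fastforce simp: r_coset_def set_mult_def SET_INV_def)
        moreover have "c \<notin> F (j i a) #> a" using c p(1) ia by (auto simp: S_def T_def)
        ultimately have "c \<in> near p" unfolding near_def ia r_coset_def fst_conv snd_conv by blast
        then show ?thesis using p(1) by blast
      qed blast
    qed
    have finnear: "finite (near p)" for p
      using F(1) I(1) by (simp add: near_def finite_r_coset finite_set_mult finite_set_inv)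
    have near: "real (card (near p)) \<le> \<delta> * l p" if "p \<in> D" for p
    proof -
      obtain i a where ia: "p = (i, a)" by (cases p)
      then have iaD: "Suc n \<le> i" "i < K" "a \<in> E" using that D(1) by auto
      have "card (near p) = card ((set_inv I <#> F (j i a)) - F (j i a))"
        unfolding near_def ia fst_conv snd_conv
        using set_mult_inv_subset[OF I(2) F(3)] iaD E(2) by (intro card_r_coset) auto
      then show ?thesis
        using inv[of n i "j i a"] J(2)[of i a] iaD by (simp add: l_def ia I_def)
    qed
    \<comment> \<open>Each boundary costs \<delta> times the length of its tile. The lengths sum to
      at most \<open>card E / (1 - \<epsilon>)\<close> by almost disjointness, which is the second
      term of \<rho>; the first term comes from \<open>bad\<close>.\<close>
    have "card (\<Union>(near ` D)) \<le> (\<Sum>p\<in>D. card (near p))" by (rule card_UN_le[OF finD])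
    then have "real (card (\<Union>(near ` D))) \<le> (\<Sum>p\<in>D. real (card (near p)))"
      by (simp flip: of_nat_sum)
    also have "\<dots> \<le> (\<Sum>p\<in>D. \<delta> * l p)" by (intro sum_mono near)
    also have "\<dots> = \<delta> / (1 - \<epsilon>) * ((1 - \<epsilon>) * sum l D)" using e by (simp add: sum_distrib_left)
    also have "\<dots> \<le> \<delta> / (1 - \<epsilon>) * real (card E)"
    proof (intro mult_left_mono)
      have "card (\<Union>(T ` D)) \<le> card E" using D(2) E(1) card_mono by blast
      then show "(1 - \<epsilon>) * sum l D \<le> real (card E)" using D(3) by linarith
    qed (use d e in simp)
    finally have nb: "real (card (\<Union>(near ` D))) \<le> \<delta> / (1 - \<epsilon>) * real (card E)" .
    have "card (E - S) \<le> card (A \<union> bad \<union> \<Union>(near ` D))"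
      using A(1) E(1) finD finnear by (intro card_mono[OF _ sub]) (auto simp: bad_def)
    also have "\<dots> \<le> card A + card bad + card (\<Union>(near ` D))"
      using card_Un_le[of "A \<union> bad" "\<Union>(near ` D)"] card_Un_le[of A bad] by linarith
    finally have rA: "real (card (E - S)) - \<rho> * real (card E) \<le> real (card A)"
      using nb Einv[OF n] by (simp add: rho algebra_simps bad_def I_def)
    obtain D1 where D1: "D1 \<subseteq> A"
      "(1 - \<epsilon>) * (\<Sum>c\<in>D1. real (card (F (j n c)))) \<le> real (card (\<Union>c\<in>D1. F (j n c) #> c))"
      "real (card A) \<le> (C / (1 - \<epsilon>) + 1 / \<epsilon>) * real (card (\<Union>c\<in>D1. F (j n c) #> c))"
      using tempered_vitali[OF F temp C e A, of "j n"] by blast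
    define S1 where "S1 = (\<Union>c\<in>D1. F (j n c) #> c)"
    have S1: "S1 \<subseteq> E - S" using D1(1) by (auto simp: S1_def A_def)
    define D' where "D' = D \<union> Pair n ` D1"
    have un: "\<Union>(T ` D') = S \<union> S1" by (auto simp: D'_def S_def S1_def T_def)
    have finD1: "finite D1" using D1(1) A(1) finite_subset by blast
    have "sum l D' = sum l D + sum l (Pair n ` D1)"
      unfolding D'_def using D(1) finD finD1 by (intro sum.union_disjoint) auto
    moreover have "sum l (Pair n ` D1) = (\<Sum>c\<in>D1. real (card (F (j n c))))"
      by (subst sum.reindex) (auto simp: inj_on_def l_def)
    moreover have "card (S \<union> S1) = card S + card S1"
      using S1 finS E(1) by (intro card_Un_disjoint) (auto intro: finite_subset)
    ultimately have "(1 - \<epsilon>) * sum l D' \<le> real (card (\<Union>(T ` D')))"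
      using D(3) D1(2) unfolding un by (simp add: S_def S1_def algebra_simps)
    moreover have "real (card (E - \<Union>(T ` D'))) \<le> ((1 - \<eta>) ^ (K - n) + \<rho>) * real (card E)"
    proof -
      have "E - \<Union>(T ` D') = (E - S) - S1" unfolding un by blast
      then have "card (E - \<Union>(T ` D')) = card (E - S) - card S1"
        using S1 E(1) by (simp add: card_Diff_subset finite_subset)
      moreover have "card S1 \<le> card (E - S)" using S1 E(1) by (intro card_mono) auto
      moreover have "\<eta> * real (card A) \<le> real (card S1)"
      proof -
        have "C / (1 - \<epsilon>) + 1 / \<epsilon> > 0" using pos by linarith
        then show ?thesis using D1(3) by (simp add: eta S1_def pos_divide_le_eq mult.commute)
      qed
      moreover have "\<eta> * (real (card (E - S)) - \<rho> * real (card E)) \<le> \<eta> * real (card A)"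
        using rA eta01 by (intro mult_left_mono) auto
      \<comment> \<open>The number \<open>\<rho> * card E\<close> is a fixed point of this affine
        recursion, so the excess over it shrinks by the factor \<open>1 - \<eta>\<close>.\<close>
      ultimately have "real (card (E - \<Union>(T ` D')))
          \<le> (1 - \<eta>) * real (card (E - S)) + \<eta> * \<rho> * real (card E)"
        by (simp add: of_nat_diff algebra_simps)
      also have "\<dots> \<le> (1 - \<eta>) * (((1 - \<eta>) ^ (K - Suc n) + \<rho>) * real (card E)) + \<eta> * \<rho> * real (card E)"
        using D(4) eta01 by (intro add_right_mono mult_left_mono) (auto simp: S_def)
      also have "\<dots> = ((1 - \<eta>) * (1 - \<eta>) ^ (K - Suc n) + \<rho>) * real (card E)"
        by (simp add: algebra_simps)
      also have "(1 - \<eta>) * (1 - \<eta>) ^ (K - Suc n) = (1 - \<eta>) ^ (K - n)"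
        using n by (metis Suc_diff_Suc power_Suc)
      finally show ?thesis .
    qed
    moreover have "\<Union>(T ` D') \<subseteq> E" using S1 D(2) unfolding un S_def by blast
    moreover have "D' \<subseteq> {n..<K} \<times> E"
      using D(1) D1(1) n by (auto simp: D'_def A_def)
    ultimately show "\<exists>D\<subseteq>{n..<K} \<times> E. \<Union>(T ` D) \<subseteq> E \<and> (1 - \<epsilon>) * sum l D \<le> real (card (\<Union>(T ` D))) \<and>
        real (card (E - \<Union>(T ` D))) \<le> ((1 - \<eta>) ^ (K - n) + \<rho>) * real (card E)"
      by blast
  qed simp
  then show ?thesis using that by (simp add: atLeast0LessThan) blast
qed

section \<open>Folner sequences\<close>

lemma folnerD:
  assumes "folner_sequence G E"
  shows "E n \<noteq> {}" "finite (E n)" "E n \<subseteq> carrier G" "card (E n) > 0"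
  using assms by (auto simp: folner_sequence_def card_gt_0_iff)

lemma folner_finite_set:
  assumes E: "folner_sequence G E" and K: "finite K" "K \<subseteq> carrier G" and d: "\<delta> > 0"
  shows "\<forall>\<^sub>F n in sequentially.
    (\<Sum>k\<in>K. real (card (sym_diff (E n) (k <# E n)))) \<le> \<delta> * real (card (E n))"
proof -
  have "(\<lambda>n. \<Sum>k\<in>K. real (card (sym_diff (E n) (k <# E n))) / real (card (E n))) \<longlonglongrightarrow> (\<Sum>k\<in>K. 0)"
    using E K by (intro tendsto_sum) (auto simp: folner_sequence_def)
  then have "\<forall>\<^sub>F n in sequentially.
      (\<Sum>k\<in>K. real (card (sym_diff (E n) (k <# E n))) / real (card (E n))) < \<delta>"
    using d by (intro order_tendstoD(2)) simp_all
  then show ?thesis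
  proof (rule eventually_mono)
    fix n assume "(\<Sum>k\<in>K. real (card (sym_diff (E n) (k <# E n))) / real (card (E n))) < \<delta>"
    then have "(\<Sum>k\<in>K. real (card (sym_diff (E n) (k <# E n)))) / real (card (E n)) < \<delta>"
      by (simp only: sum_divide_distrib)
    then show "(\<Sum>k\<in>K. real (card (sym_diff (E n) (k <# E n)))) \<le> \<delta> * real (card (E n))"
      using folnerD(4)[OF E, of n] by (simp add: pos_divide_less_eq)
  qed
qed

lemma card_le_sum_sym_diff:
  assumes "finite K" "finite E" "B \<subseteq> (\<Union>k\<in>K. sym_diff E (k <# E))"
  shows "real (card B) \<le> (\<Sum>k\<in>K. real (card (sym_diff E (k <# E))))"
proof -
  have "card B \<le> card (\<Union>k\<in>K. sym_diff E (k <# E))"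
    using assms by (intro card_mono) (auto simp: l_coset_def)
  also have "\<dots> \<le> (\<Sum>k\<in>K. card (sym_diff E (k <# E)))" by (rule card_UN_le[OF assms(1)])
  finally show ?thesis by (simp flip: of_nat_sum)
qed

lemma folner_eventually_set_mult:
  assumes E: "folner_sequence G E" and K: "finite K" "K \<subseteq> carrier G" and d: "\<delta> > 0"
  shows "\<forall>\<^sub>F n in sequentially. real (card ((K <#> E n) - E n)) \<le> \<delta> * real (card (E n))"
  using folner_finite_set[OF E K d]
proof (rule eventually_mono)
  fix n assume le: "(\<Sum>k\<in>K. real (card (sym_diff (E n) (k <# E n)))) \<le> \<delta> * real (card (E n))"
  have "(K <#> E n) - E n \<subseteq> (\<Union>k\<in>K. sym_diff (E n) (k <# E n))"
    unfolding set_mult_def l_coset_def by blast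
  from card_le_sum_sym_diff[OF K(1) folnerD(2)[OF E] this] le
  show "real (card ((K <#> E n) - E n)) \<le> \<delta> * real (card (E n))" by linarith
qed

text \<open>If \<open>k \<otimes> c\<close> leaves \<open>E n\<close> for some
  \<open>c \<in> E n\<close>, then \<open>c\<close> is not in \<open>inv k <# E n\<close>. Hence
  invariance is used for the inverses of the elements of \<open>K\<close>.\<close>

lemma folner_eventually_core:
  assumes E: "folner_sequence G E" and K: "finite K" "K \<subseteq> carrier G" and d: "\<delta> > 0"
  shows "\<forall>\<^sub>F n in sequentially. real (card {c \<in> E n. \<not> K #> c \<subseteq> E n}) \<le> \<delta> * real (card (E n))"
proof -
  have K': "finite (set_inv K)" "set_inv K \<subseteq> carrier G"
    using K by (auto simp: SET_INV_def)
  show ?thesis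
    using folner_finite_set[OF E K' d]
  proof (rule eventually_mono)
    fix n
    assume le: "(\<Sum>k\<in>set_inv K. real (card (sym_diff (E n) (k <# E n)))) \<le> \<delta> * real (card (E n))"
    have "{c \<in> E n. \<not> K #> c \<subseteq> E n} \<subseteq> (\<Union>k\<in>set_inv K. sym_diff (E n) (k <# E n))"
    proof
      fix c assume "c \<in> {c \<in> E n. \<not> K #> c \<subseteq> E n}"
      then obtain k where k: "c \<in> E n" "k \<in> K" "k \<otimes> c \<notin> E n" by (auto simp: r_coset_def)
      have "c \<notin> inv k <# E n"
      proof
        assume "c \<in> inv k <# E n"
        then obtain a where a: "a \<in> E n" "c = inv k \<otimes> a" by (auto simp: l_coset_def)
        then have "a \<in> carrier G" "k \<in> carrier G" using k(2) K(2) folnerD(3)[OF E, of n] by auto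
        then have "k \<otimes> c = a" using a(2) by (simp add: m_assoc[symmetric])
        then show False using a k by simp
      qed
      moreover have "inv k \<in> set_inv K" using k by (auto simp: SET_INV_def)
      ultimately show "c \<in> (\<Union>k\<in>set_inv K. sym_diff (E n) (k <# E n))" using k(1) by blast
    qed
    from card_le_sum_sym_diff[OF K'(1) folnerD(2)[OF E] this] le
    show "real (card {c \<in> E n. \<not> K #> c \<subseteq> E n}) \<le> \<delta> * real (card (E n))" by linarith
  qed
qed

section \<open>Growth of Folner sets and tempered subsequences\<close>

text \<open>Take \<open>K\<close> with \<open>m + 1\<close> elements and invariance constant
  \<open>1 / (m + 1)\<close>. If \<open>E n\<close> had fewer than \<open>m\<close> elements, fewer
  than one point of \<open>K <#> E n\<close> would lie outside \<open>E n\<close>, so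
  \<open>E n\<close> would contain a translate of \<open>K\<close>.\<close>

lemma folner_card_at_top:
  assumes E: "folner_sequence G E" and inf: "infinite (carrier G)"
  shows "filterlim (\<lambda>n. card (E n)) at_top sequentially"
  unfolding filterlim_at_top
proof
  fix m
  obtain K where K: "finite K" "card K = Suc m" "K \<subseteq> carrier G"
    using infinite_arbitrarily_large[OF inf] by blast
  have "\<forall>\<^sub>F n in sequentially. real (card ((K <#> E n) - E n)) \<le> 1 / (real m + 1) * real (card (E n))"
    by (rule folner_eventually_set_mult[OF E K(1,3)]) simp
  then show "\<forall>\<^sub>F n in sequentially. m \<le> card (E n)"
  proof (rule eventually_mono)
    fix n assume le: "real (card ((K <#> E n) - E n)) \<le> 1 / (real m + 1) * real (card (E n))"
    show "m \<le> card (E n)"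
    proof (rule ccontr)
      assume "\<not> m \<le> card (E n)"
      then have "1 / (real m + 1) * real (card (E n)) < 1" by (simp add: field_simps)
      then have "card ((K <#> E n) - E n) = 0" using le by linarith
      then have sub: "K <#> E n \<subseteq> E n"
        using finite_set_mult[OF K(1) folnerD(2)[OF E, of n]] by simp
      obtain a where a: "a \<in> E n" using folnerD(1)[OF E] by blast
      then have "K #> a \<subseteq> E n" using sub by (auto simp: set_mult_def r_coset_def)
      then have "card (K #> a) \<le> card (E n)" using folnerD(2)[OF E] card_mono by blast
      moreover have "card (K #> a) = Suc m"
        using card_r_coset[OF K(3), of a] a folnerD(3)[OF E, of n] K(2) by auto
      ultimately show False using \<open>\<not> m \<le> card (E n)\<close> by simp
    qed
  qed
qed

lemma folner_subseq:
  "folner_sequence G E \<Longrightarrow> strict_mono r \<Longrightarrow> folner_sequence G (E \<circ> r)"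
  unfolding folner_sequence_def
  using LIMSEQ_subseq_LIMSEQ[of "\<lambda>n. real (card (sym_diff (E n) (_ <# E n))) / real (card (E n))" 0 r]
  by (simp add: o_def)

text \<open>Each new set is taken so invariant under the inverses of the earlier ones that the
  product adds at most as many points as the set has. This gives the temperedness constant
  2.\<close>

lemma folner_tempered_subseq:
  assumes E: "folner_sequence G E"
  obtains r where "strict_mono r" "tempered G (E \<circ> r)"
proof -
  \<comment> \<open>All sets up to index \<open>m\<close> enter, not only the chosen ones, so that
    the next choice depends on the last index alone and \<open>dependent_nat_choice\<close>
    applies.\<close>
  define K where "K m = set_inv (\<Union>i\<le>m. E i)" for m
  have K: "finite (K m)" "K m \<subseteq> carrier G" for m
    using folnerD(2,3)[OF E] by (fastforce simp: K_def SET_INV_def)+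
  define Q where "Q m m' \<longleftrightarrow> m < m' \<and> real (card ((K m <#> E m') - E m')) \<le> real (card (E m'))" for m m'
  have "\<exists>m'. Q m m'" for m
  proof -
    have "\<forall>\<^sub>F n in sequentially. real (card ((K m <#> E n) - E n)) \<le> 1 * real (card (E n)) \<and> m < n"
      using folner_eventually_set_mult[OF E K, of 1 m] eventually_gt_at_top[of m]
      by (intro eventually_conj) auto
    then show ?thesis unfolding Q_def eventually_sequentially by (metis mult_1 order_refl)
  qed
  then obtain r where r: "\<And>n. Q (r n) (r (Suc n))"
    using dependent_nat_choice[of "\<lambda>_ _. True" "\<lambda>_. Q"] by blast
  have mono: "strict_mono r" using r by (auto simp: Q_def strict_mono_Suc_iff)
  have "real (card (\<Union>k<n. set_inv (E (r k)) <#> E (r n))) \<le> 2 * real (card (E (r n)))" for n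
  proof (cases n)
    case (Suc m)
    have "(\<Union>k<n. set_inv (E (r k)) <#> E (r n)) \<subseteq> ((K (r m) <#> E (r n)) - E (r n)) \<union> E (r n)"
    proof
      fix g assume "g \<in> (\<Union>k<n. set_inv (E (r k)) <#> E (r n))"
      then obtain k where k: "k \<le> m" "g \<in> set_inv (E (r k)) <#> E (r n)"
        unfolding Suc by (auto simp: less_Suc_eq_le)
      have "r k \<le> r m" using mono k(1) by (simp add: strict_mono_less_eq)
      then have "set_inv (E (r k)) \<subseteq> K (r m)" by (auto simp: K_def SET_INV_def)
      then show "g \<in> ((K (r m) <#> E (r n)) - E (r n)) \<union> E (r n)"
        using k(2) by (auto simp: set_mult_def)
    qed
    then have "card (\<Union>k<n. set_inv (E (r k)) <#> E (r n)) \<le> card (((K (r m) <#> E (r n)) - E (r n)) \<union> E (r n))"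
      using K(1) folnerD(2)[OF E] by (intro card_mono) (auto simp: finite_set_mult)
    also have "\<dots> \<le> card ((K (r m) <#> E (r n)) - E (r n)) + card (E (r n))" by (rule card_Un_le)
    finally show ?thesis using r[of m] by (simp add: Q_def Suc)
  qed simp
  then have "tempered G (E \<circ> r)" unfolding tempered_def by (intro exI[of _ 2]) simp
  with mono show ?thesis using that by blast
qed

end

section \<open>Words and covers\<close>

text \<open>All families are weighed at once: the generating function
  \<open>(\<Prod>p\<in>W. 1 + exp (- s * l p))\<close> dominates \<open>exp (- s * L)\<close> times the number of families.\<close>

lemma card_families_le_exp:
  fixes l :: "'a \<Rightarrow> real"
  assumes W: "finite W" "\<P> \<subseteq> Pow W" and s: "s \<ge> 0"
    and L: "\<And>P. P \<in> \<P> \<Longrightarrow> sum l P \<le> L"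
  shows "real (card \<P>) \<le> exp (s * L + (\<Sum>p\<in>W. exp (- s * l p)))"
proof -
  have "exp (- s * L) * real (card \<P>) = (\<Sum>P\<in>\<P>. exp (- s * L))" by simp
  also have "\<dots> \<le> (\<Sum>P\<in>\<P>. \<Prod>p\<in>P. exp (- s * l p))"
  proof (rule sum_mono)
    fix P assume P: "P \<in> \<P>"
    then have "finite P" using W finite_subset by blast
    then have "(\<Prod>p\<in>P. exp (- s * l p)) = exp (- s * sum l P)"
      by (simp add: exp_sum[symmetric] sum_distrib_left)
    then show "exp (- s * L) \<le> (\<Prod>p\<in>P. exp (- s * l p))"
      using L[OF P] s by (simp add: mult_left_mono)
  qed
  also have "\<dots> \<le> (\<Sum>P\<in>Pow W. \<Prod>p\<in>P. exp (- s * l p))"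
    using W by (intro sum_mono2) (auto intro: prod_nonneg)
  also have "\<dots> = (\<Prod>p\<in>W. exp (- s * l p) + 1)"
    using prod_add[OF W(1), of "\<lambda>p. exp (- s * l p)" "\<lambda>_. 1"] by simp
  also have "\<dots> \<le> (\<Prod>p\<in>W. exp (exp (- s * l p)))"
    by (intro prod_mono conjI) (auto simp: add.commute intro!: add_nonneg_nonneg)
  also have "\<dots> = exp (\<Sum>p\<in>W. exp (- s * l p))" using W(1) by (simp add: exp_sum)
  finally show ?thesis by (simp add: exp_add exp_minus field_simps)
qed

lemma wordsI:
  assumes "\<And>g. g \<in> E \<Longrightarrow> \<exists>U\<in>\<U>. w g = Some U" and "\<And>g. g \<notin> E \<Longrightarrow> w g = None"
  shows "w \<in> words \<U> E"
proof -
  have "dom w = E" using assms by (metis (no_types, lifting) domI domIff subsetI subset_antisym option.distinct(1))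
  moreover have "U \<in> \<U>" if "w g = Some U" for g U
    using assms that by (metis option.distinct(1) option.inject)
  ultimately show ?thesis by (auto simp: words_def ran_def)
qed

lemma finite_words: "finite \<U> \<Longrightarrow> finite E \<Longrightarrow> finite (words \<U> E)"
  and card_words_le: "finite \<U> \<Longrightarrow> finite E \<Longrightarrow> card (words \<U> E) \<le> card \<U> ^ card E"
proof -
  assume fin: "finite \<U>" "finite E"
  have sub: "words \<U> E \<subseteq> (\<lambda>h g. if g \<in> E then Some (h g) else None) ` (E \<rightarrow>\<^sub>E \<U>)"
  proof
    fix u assume u: "u \<in> words \<U> E"
    have "(\<lambda>g\<in>E. the (u g)) \<in> E \<rightarrow>\<^sub>E \<U>"
      using u by (auto simp: words_def ran_def)
    moreover have "u = (\<lambda>g. if g \<in> E then Some ((\<lambda>g\<in>E. the (u g)) g) else None)"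
      using u by (auto simp: words_def dom_def fun_eq_iff)
    ultimately show "u \<in> (\<lambda>h g. if g \<in> E then Some (h g) else None) ` (E \<rightarrow>\<^sub>E \<U>)" by blast
  qed
  have finP: "finite (E \<rightarrow>\<^sub>E \<U>)" using fin by (simp add: finite_PiE)
  show "finite (words \<U> E)" using finP sub finite_surj by blast
  show "card (words \<U> E) \<le> card \<U> ^ card E"
    using surj_card_le[OF finP sub] card_PiE[OF fin(2), of "\<lambda>_. \<U>"] by simp
qed

lemma cover_number_le_card:
  assumes "finite V" "V \<subseteq> words \<U> E" "topspace X \<subseteq> (\<Union>v\<in>V. word_set X \<phi> v)"
  shows "cover_number X (iterated_cover X \<phi> \<U> E) \<le> card V"
proof -
  have "cover_number X (iterated_cover X \<phi> \<U> E) \<le> card (word_set X \<phi> ` V)"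
    unfolding cover_number_def iterated_cover_def
    by (rule Least_le, rule exI[of _ "word_set X \<phi> ` V"]) (use assms in auto)
  then show ?thesis using card_image_le[OF assms(1), of "word_set X \<phi>"] by linarith
qed

abbreviation cover_rate ::
    "'x topology \<Rightarrow> ('g \<Rightarrow> 'x \<Rightarrow> 'x) \<Rightarrow> 'x set set \<Rightarrow> 'g set \<Rightarrow> real" where
  "cover_rate X \<phi> \<U> E \<equiv> ln (real (cover_number X (iterated_cover X \<phi> \<U> E))) / real (card E)"

section \<open>Vanishing of the Bowen measure\<close>

lemma incseq_bowen_premeasure: "incseq (bowen_premeasure X \<phi> F \<U> Z s)"
  unfolding incseq_def bowen_premeasure_def
  by (intro allI impI INF_superset_mono order_refl) fastforce

text \<open>By monotonicity the limit is a supremum, so it vanishes only if every term does.\<close>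

lemma bowen_measure_eq_0_iff:
  "bowen_measure X \<phi> F \<U> Z s = 0 \<longleftrightarrow> (\<forall>N. bowen_premeasure X \<phi> F \<U> Z s N = 0)"
proof -
  have "bowen_measure X \<phi> F \<U> Z s = (SUP N. bowen_premeasure X \<phi> F \<U> Z s N)"
    unfolding bowen_measure_def by (intro limI LIMSEQ_SUP incseq_bowen_premeasure)
  then show ?thesis by (simp add: SUP_eq_iff flip: bot_ennreal) 
qed

context group
begin

section \<open>Itineraries and cover numbers for an action\<close>

context
  fixes X :: "'x topology" and \<phi> :: "'a \<Rightarrow> 'x \<Rightarrow> 'x" and \<U> :: "'x set set"
  assumes act: "acts_by_homeomorphisms G X \<phi>" and cov: "finite_open_cover X \<U>"
begin

lemma act_mult:
  "g \<in> carrier G \<Longrightarrow> h \<in> carrier G \<Longrightarrow> x \<in> topspace X \<Longrightarrow> \<phi> (g \<otimes> h) x = \<phi> g (\<phi> h x)"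
  using act group_action.composition_rule by (fastforce simp: acts_by_homeomorphisms_def)

lemma act_in_topspace: "g \<in> carrier G \<Longrightarrow> x \<in> topspace X \<Longrightarrow> \<phi> g x \<in> topspace X"
  using act group_action.element_image by (fastforce simp: acts_by_homeomorphisms_def)

lemma finite_cover: "finite \<U>"
  using cov by (simp add: finite_open_cover_def)

lemma word_through_point:
  assumes E: "E \<subseteq> carrier G" and x: "x \<in> topspace X"
  obtains v where "v \<in> words \<U> E" "x \<in> word_set X \<phi> v"
proof -
  have "\<forall>g\<in>E. \<exists>U\<in>\<U>. \<phi> g x \<in> U"
  proof
    fix g assume "g \<in> E"
    then have "\<phi> g x \<in> \<Union>\<U>"
      using act_in_topspace[OF _ x, of g] E cov by (auto simp: finite_open_cover_def)
    then show "\<exists>U\<in>\<U>. \<phi> g x \<in> U" by blast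
  qed
  then obtain U where U: "\<And>g. g \<in> E \<Longrightarrow> U g \<in> \<U> \<and> \<phi> g x \<in> U g" by metis
  show ?thesis
    by (rule that[of "\<lambda>g. if g \<in> E then Some (U g) else None"])
      (use U x in \<open>auto simp: words_def word_set_def ran_def dom_def split: if_splits\<close>)
qed

text \<open>Different words may define the same set. Choosing one word for each member of a minimal
  subcover passes from sets to words without changing the cardinality.\<close>

lemma cover_number_attained:
  assumes E: "finite E" "E \<subseteq> carrier G"
  obtains V where "finite V" "V \<subseteq> words \<U> E" "topspace X \<subseteq> (\<Union>v\<in>V. word_set X \<phi> v)"
    "card V = cover_number X (iterated_cover X \<phi> \<U> E)"
proof -
  let ?W = "iterated_cover X \<phi> \<U> E"
  have "finite ?W" using finite_words[OF finite_cover E(1)] by (simp add: iterated_cover_def)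
  moreover have "topspace X \<subseteq> \<Union>?W"
  proof
    fix x assume "x \<in> topspace X"
    then obtain v where "v \<in> words \<U> E" "x \<in> word_set X \<phi> v"
      by (rule word_through_point[OF E(2)])
    then show "x \<in> \<Union>?W" by (auto simp: iterated_cover_def)
  qed
  ultimately have "\<exists>k. \<exists>\<W>. \<W> \<subseteq> ?W \<and> finite \<W> \<and> topspace X \<subseteq> \<Union>\<W> \<and> card \<W> = k" by blast
  from LeastI_ex[OF this] obtain \<W> where W: "\<W> \<subseteq> ?W" "finite \<W>" "topspace X \<subseteq> \<Union>\<W>"
    "card \<W> = cover_number X ?W" unfolding cover_number_def by blast
  then obtain V where V: "V \<subseteq> words \<U> E" "inj_on (word_set X \<phi>) V" "\<W> = word_set X \<phi> ` V"
    unfolding iterated_cover_def subset_image_inj by blast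
  show ?thesis
  proof (rule that[of V])
    show "finite V" using W(2) V by (simp add: finite_image_iff)
    show "topspace X \<subseteq> (\<Union>v\<in>V. word_set X \<phi> v)" using W(3) V(3) by simp
    show "card V = cover_number X ?W" using W(4) V by (simp add: card_image)
  qed (rule V(1))
qed

lemma cover_number_le_power:
  assumes E: "finite E" "E \<subseteq> carrier G"
  shows "cover_number X (iterated_cover X \<phi> \<U> E) \<le> card \<U> ^ card E"
proof -
  have "cover_number X (iterated_cover X \<phi> \<U> E) \<le> card (words \<U> E)"
    using word_through_point[OF E(2)] finite_words[OF finite_cover E(1)]
    by (intro cover_number_le_card) auto
  also have "\<dots> \<le> card \<U> ^ card E" by (rule card_words_le[OF finite_cover E(1)])
  finally show ?thesis .
qed

lemma openin_word_set:
  assumes "u \<in> words \<U> E" "finite E" "E \<subseteq> carrier G"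
  shows "openin X (word_set X \<phi> u)"
proof -
  have dom: "dom u = E" using assms by (simp add: words_def)
  have "openin X {x \<in> topspace X. \<phi> g x \<in> the (u g)}" if "g \<in> E" for g
  proof (rule openin_continuous_map_preimage)
    show "continuous_map X X (\<phi> g)"
      using act that assms(3) by (auto simp: acts_by_homeomorphisms_def intro: homeomorphic_imp_continuous_map)
    show "openin X (the (u g))"
      using that assms(1) cov by (auto simp: words_def finite_open_cover_def ran_def dom_def)
  qed
  then have "openin X (topspace X \<inter> (\<Inter>g\<in>E. {x \<in> topspace X. \<phi> g x \<in> the (u g)}))"
    using assms(2) by (cases "E = {}") (auto intro!: openin_Int openin_Inter)
  moreover have "word_set X \<phi> u = topspace X \<inter> (\<Inter>g\<in>E. {x \<in> topspace X. \<phi> g x \<in> the (u g)})"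
    by (auto simp: word_set_def dom)
  ultimately show ?thesis by simp
qed

section \<open>Counting itineraries along tilings\<close>

text \<open>An itinerary over \<open>E\<close> is encoded by a family \<open>P\<close> of pairs
  (centre, word) and a word on the uncovered part \<open>R P\<close>. The families contribute the
  terms with \<open>s\<close> and \<gamma> through \<open>card_families_le_exp\<close>. For each of
  them there are at most \<open>card \<U> ^ card (R P)\<close> words on the rest, which gives the
  term with \<rho>.\<close>

lemma ln_cover_number_le_tiling:
  fixes F :: "nat \<Rightarrow> 'a set" and J :: "nat \<Rightarrow> nat set" and \<Lambda> :: "nat \<Rightarrow> ('a \<rightharpoonup> 'x set) set"
  assumes F: "\<And>n. finite (F n)" "\<And>n. F n \<noteq> {}" "\<And>n. F n \<subseteq> carrier G"
    and temp: "\<And>n. real (card (\<Union>k<n. set_inv (F k) <#> F n)) \<le> C * real (card (F n))"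
    and C: "C \<ge> 0" and e: "0 < \<epsilon>" "\<epsilon> < 1" and d: "\<delta> \<ge> 0"
    and E: "finite E" "E \<subseteq> carrier G"
    and J: "\<And>i. finite (J i)"
    and inv: "\<And>i i' m. i < i' \<Longrightarrow> i' < K \<Longrightarrow> m \<in> J i' \<Longrightarrow>
      real (card ((set_inv (\<Union>k\<in>J i. F k) <#> F m) - F m)) \<le> \<delta> * real (card (F m))"
    and Einv: "\<And>i. i < K \<Longrightarrow>
      real (card {c \<in> E. \<not> (\<Union>k\<in>J i. F k) #> c \<subseteq> E}) \<le> \<delta> * real (card E)"
    and eta: "\<eta> = 1 / (C / (1 - \<epsilon>) + 1 / \<epsilon>)"
    and rho: "\<rho> = (1 - \<eta>) ^ K + (\<delta> + \<delta> / (1 - \<epsilon>))"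
    and \<Lambda>: "\<And>i. finite (\<Lambda> i)" "\<And>i. \<Lambda> i \<subseteq> (\<Union>k\<in>J i. words \<U> (F k))"
      "\<And>i. topspace X \<subseteq> (\<Union>u\<in>\<Lambda> i. word_set X \<phi> u)"
    and s: "s \<ge> 0" and \<gamma>: "\<And>i. (\<Sum>u\<in>\<Lambda> i. exp (- s * real (card (dom u)))) \<le> \<gamma>"
    and ne: "topspace X \<noteq> {}"
  shows "ln (real (cover_number X (iterated_cover X \<phi> \<U> E)))
    \<le> (s / (1 - \<epsilon>) + real K * \<gamma> + \<rho> * ln (real (card \<U>))) * real (card E)"
proof -
  let ?N = "cover_number X (iterated_cover X \<phi> \<U> E)"
  define L where "L = (\<Union>i<K. \<Lambda> i)"
  define W where "W = E \<times> L"
  define R where "R P = E - (\<Union>(c, u)\<in>P. dom u #> c)" for P :: "('a \<times> ('a \<rightharpoonup> 'x set)) set"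
  define l where "l p = real (card (dom (snd p)))" for p :: "'a \<times> ('a \<rightharpoonup> 'x set)"
  define \<P> where "\<P> = {P \<in> Pow W. sum l P \<le> real (card E) / (1 - \<epsilon>) \<and>
    real (card (R P)) \<le> \<rho> * real (card E)}"
  \<comment> \<open>Overlapping tiles may prescribe several sets at \<open>g\<close>. When
    \<open>P\<close> arises from a point \<open>x\<close>, each of them contains
    \<open>\<phi> g x\<close>, so the choice is arbitrary.\<close>
  define val where "val P g = (SOME U. \<exists>(c, u)\<in>P. \<exists>h\<in>dom u. g = h \<otimes> c \<and> u h = Some U)"
    for P :: "('a \<times> ('a \<rightharpoonup> 'x set)) set" and g
  define f where "f = (\<lambda>(P, v) g. if g \<in> R P then v g else if g \<in> E then Some (val P g) else None)"
  define I where "I = Sigma \<P> (\<lambda>P. words \<U> (R P))"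
  have finL: "finite L" using \<Lambda>(1) by (simp add: L_def)
  have finW: "finite W" using finL E(1) by (simp add: W_def)
  have fin\<P>: "finite \<P>" using finW by (simp add: \<P>_def)
  have finR: "finite (R P)" for P using E(1) by (simp add: R_def)
  have finI: "finite I" using fin\<P> finite_words[OF finite_cover finR] by (auto simp: I_def)
  have L: "dom u \<subseteq> carrier G" "ran u \<subseteq> \<U>" if "u \<in> L" for u
    using that \<Lambda>(2) F(3) by (fastforce simp: L_def words_def)+
  have val: "\<exists>(c, u)\<in>P. \<exists>h\<in>dom u. g = h \<otimes> c \<and> u h = Some (val P g)"
    if g: "g \<in> E" "g \<notin> R P" for P g
    unfolding val_def
  proof (rule someI_ex)
    obtain c u where cu: "(c, u) \<in> P" "g \<in> dom u #> c" using g by (auto simp: R_def)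
    then obtain h where h: "h \<in> dom u" "g = h \<otimes> c" by (auto simp: r_coset_def)
    then obtain U where "u h = Some U" by blast
    with cu h show "\<exists>U. \<exists>(c, u)\<in>P. \<exists>h\<in>dom u. g = h \<otimes> c \<and> u h = Some U" by blast
  qed
  have fwords: "f ` I \<subseteq> words \<U> E"
  proof
    fix w assume "w \<in> f ` I"
    then obtain P v where Pv: "P \<in> \<P>" "v \<in> words \<U> (R P)" "w = f (P, v)" by (auto simp: I_def)
    have RE: "R P \<subseteq> E" by (auto simp: R_def)
    have v: "\<exists>U\<in>\<U>. v g = Some U" if "g \<in> R P" for g
    proof -
      have "dom v = R P" "ran v \<subseteq> \<U>" using Pv(2) by (simp_all add: words_def)
      then show ?thesis using that ranI by (metis domD subsetD)
    qed
    have w: "w g = (if g \<in> R P then v g else if g \<in> E then Some (val P g) else None)" for g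
      by (simp add: Pv(3) f_def)
    have "\<exists>U\<in>\<U>. w g = Some U" if g: "g \<in> E" for g
    proof (cases "g \<in> R P")
      case True
      then show ?thesis using v by (simp add: w)
    next
      case False
      obtain c u h where cu: "(c, u) \<in> P" "u h = Some (val P g)" using val[OF g False] by blast
      then have "u \<in> L" using Pv(1) by (auto simp: \<P>_def W_def)
      then have "val P g \<in> \<U>" using L(2) cu(2) ranI by fast
      then show ?thesis using False g by (simp add: w)
    qed
    moreover have "w g = None" if "g \<notin> E" for g using that RE by (auto simp: w)
    ultimately show "w \<in> words \<U> E" by (intro wordsI) auto
  qed
  have "topspace X \<subseteq> (\<Union>w\<in>f ` I. word_set X \<phi> w)"
  proof
    fix x assume x: "x \<in> topspace X"
    \<comment> \<open>The word of level \<open>i\<close> through \<open>\<phi> c x\<close> decides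
      which \<open>F k\<close> is used as the tile at \<open>c\<close>. The function
      \<open>j\<close> handed to the tiling lemma therefore depends on \<open>x\<close>.\<close>
    have "\<exists>u k. u \<in> \<Lambda> i \<and> \<phi> c x \<in> word_set X \<phi> u \<and> k \<in> J i \<and> dom u = F k" if c: "c \<in> E" for i c
    proof -
      have "\<phi> c x \<in> topspace X" using act_in_topspace x c E by auto
      then obtain u where u: "u \<in> \<Lambda> i" "\<phi> c x \<in> word_set X \<phi> u" using \<Lambda>(3) by blast
      then obtain k where "k \<in> J i" "u \<in> words \<U> (F k)" using \<Lambda>(2) by blast
      with u show ?thesis by (auto simp: words_def)
    qed
    then have "\<forall>i c. \<exists>p. c \<in> E \<longrightarrow> fst p \<in> \<Lambda> i \<and> \<phi> c x \<in> word_set X \<phi> (fst p) \<and>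
        snd p \<in> J i \<and> dom (fst p) = F (snd p)" by simp
    then obtain p where p: "\<And>i c. c \<in> E \<Longrightarrow> fst (p i c) \<in> \<Lambda> i \<and> \<phi> c x \<in> word_set X \<phi> (fst (p i c)) \<and>
        snd (p i c) \<in> J i \<and> dom (fst (p i c)) = F (snd (p i c))" unfolding choice_iff by blast
    define u where "u i c = fst (p i c)" for i c
    define j where "j i c = snd (p i c)" for i c
    have uj: "u i c \<in> \<Lambda> i" "\<phi> c x \<in> word_set X \<phi> (u i c)" "j i c \<in> J i" "dom (u i c) = F (j i c)"
      if "c \<in> E" for i c
      using p[OF that] by (simp_all add: u_def j_def)
    obtain D where D: "D \<subseteq> {..<K} \<times> E"
      "\<Union>((\<lambda>p. F (j (fst p) (snd p)) #> snd p) ` D) \<subseteq> E"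
      "(1 - \<epsilon>) * (\<Sum>p\<in>D. real (card (F (j (fst p) (snd p)))))
        \<le> real (card (\<Union>((\<lambda>p. F (j (fst p) (snd p)) #> snd p) ` D)))"
      "real (card (E - \<Union>((\<lambda>p. F (j (fst p) (snd p)) #> snd p) ` D))) \<le> \<rho> * real (card E)"
      unfolding rho
      by (rule multilevel_tiling[where j = j and J = J and K = K, OF F temp C e d E J _ inv Einv eta refl])
        (use uj in auto)
    have finD: "finite D" using D(1) E(1) by (meson finite_SigmaI finite_lessThan finite_subset)
    \<comment> \<open>The level is forgotten, since centre and word already determine the tile.
      Elements of \<open>D\<close> may merge under \<open>q\<close>, which can only lower the total
      length.\<close>
    define q where "q = (\<lambda>(i, c). (c, u i c))"
    define P where "P = q ` D"
    have lq: "l (q p) = real (card (F (j (fst p) (snd p))))" if "p \<in> D" for p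
      using that D(1) uj by (auto simp: l_def q_def split: prod.splits)
    have RP: "R P = E - \<Union>((\<lambda>p. F (j (fst p) (snd p)) #> snd p) ` D)"
    proof -
      have "(\<Union>(c, u)\<in>P. dom u #> c) = (\<Union>p\<in>D. F (j (fst p) (snd p)) #> snd p)"
        unfolding P_def q_def UN_simps image_image using D(1) uj
        by (intro SUP_cong refl) (auto split: prod.splits)
      then show ?thesis by (simp add: R_def)
    qed
    have "P \<in> \<P>"
    proof -
      have "P \<subseteq> W" using D(1) uj by (fastforce simp: P_def q_def W_def L_def)
      moreover have "sum l P \<le> real (card E) / (1 - \<epsilon>)"
      proof -
        have "sum l P \<le> sum (l \<circ> q) D"
          unfolding P_def by (rule sum_image_le[OF finD]) (simp add: l_def)
        also have "\<dots> = (\<Sum>p\<in>D. real (card (F (j (fst p) (snd p)))))"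
          using lq by (intro sum.cong) auto
        finally have "(1 - \<epsilon>) * sum l P \<le> (1 - \<epsilon>) * (\<Sum>p\<in>D. real (card (F (j (fst p) (snd p)))))"
          using e by (intro mult_left_mono) auto
        also have "\<dots> \<le> real (card E)"
          using D(3) card_mono[OF E(1) D(2)] by linarith
        finally show ?thesis using e by (simp add: pos_le_divide_eq mult.commute)
      qed
      moreover have "real (card (R P)) \<le> \<rho> * real (card E)" using D(4) RP by simp
      ultimately show ?thesis by (simp add: \<P>_def)
    qed
    moreover obtain v where v: "v \<in> words \<U> (R P)" "x \<in> word_set X \<phi> v"
      using word_through_point[of "R P" x] x E(2) by (auto simp: R_def)
    ultimately have Pv: "(P, v) \<in> I" by (simp add: I_def)
    have "x \<in> word_set X \<phi> (f (P, v))"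
    proof -
      have "\<phi> g x \<in> the (f (P, v) g)" if g: "g \<in> E" for g
      proof (cases "g \<in> R P")
        case True
        then show ?thesis using v by (auto simp: f_def word_set_def words_def)
      next
        case False
        from val[OF g False] obtain c u' h where c: "(c, u') \<in> P" "h \<in> dom u'" "g = h \<otimes> c"
          "u' h = Some (val P g)" by blast
        then obtain i where i: "i < K" "c \<in> E" "u' = u i c" using D(1) by (auto simp: P_def q_def)
        have "u' \<in> L" using i uj by (auto simp: L_def)
        then have "h \<in> carrier G" "c \<in> carrier G" using L c i E(2) by auto
        then have "\<phi> g x = \<phi> h (\<phi> c x)" using act_mult x c(3) by simp
        moreover have "\<phi> h (\<phi> c x) \<in> the (u' h)"
          using uj[OF i(2), of i] c(2) i(3) by (auto simp: word_set_def)
        ultimately show ?thesis using False g c(4) by (simp add: f_def)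
      qed
      moreover have "dom (f (P, v)) = E" using fwords Pv by (auto simp: words_def)
      ultimately show ?thesis using x by (simp add: word_set_def)
    qed
    then show "x \<in> (\<Union>w\<in>f ` I. word_set X \<phi> w)" using Pv by blast
  qed
  then have "?N \<le> card (f ` I)" using finI fwords by (intro cover_number_le_card) auto
  also have "\<dots> \<le> card I" by (rule card_image_le[OF finI])
  finally have NI: "real ?N \<le> real (card I)" by simp
  have U1: "real (card \<U>) \<ge> 1"
  proof -
    have "\<U> \<noteq> {}" using ne cov unfolding finite_open_cover_def by (metis Union_empty)
    then have "card \<U> > 0" using finite_cover by (simp add: card_gt_0_iff)
    then show ?thesis by simp
  qed
  \<comment> \<open>There are \<open>card E\<close> centres, and at each of them \<open>K\<close>
    levels of weight at most \<gamma>.\<close>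
  have weight: "(\<Sum>p\<in>W. exp (- s * l p)) \<le> real K * \<gamma> * real (card E)"
  proof -
    let ?w = "\<lambda>u. exp (- s * real (card (dom u)))"
    have "L = snd ` Sigma {..<K} \<Lambda>" by (force simp: L_def)
    then have "sum ?w L \<le> sum (?w \<circ> snd) (Sigma {..<K} \<Lambda>)"
      using \<Lambda>(1) by (simp only:) (rule sum_image_le, auto)
    also have "\<dots> = (\<Sum>i<K. sum ?w (\<Lambda> i))"
      using \<Lambda>(1) by (subst sum.Sigma) (auto simp: case_prod_beta)
    also have "\<dots> \<le> (\<Sum>i<K. \<gamma>)" by (intro sum_mono \<gamma>)
    finally have "sum ?w L \<le> real K * \<gamma>" by simp
    then have "real (card E) * sum ?w L \<le> real (card E) * (real K * \<gamma>)"
      by (intro mult_left_mono) auto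
    moreover have "(\<Sum>p\<in>W. exp (- s * l p)) = (\<Sum>c\<in>E. sum ?w L)"
      unfolding W_def by (subst sum.cartesian_product) (simp add: l_def case_prod_beta)
    ultimately show ?thesis by (simp add: mult_ac)
  qed
  have "real (card \<P>) \<le> exp (s * (real (card E) / (1 - \<epsilon>)) + (\<Sum>p\<in>W. exp (- s * l p)))"
    by (rule card_families_le_exp[OF finW _ s]) (auto simp: \<P>_def)
  also have "\<dots> \<le> exp (s * (real (card E) / (1 - \<epsilon>)) + real K * \<gamma> * real (card E))"
    using weight by simp
  finally have families: "real (card \<P>) \<le> exp (s * (real (card E) / (1 - \<epsilon>)) + real K * \<gamma> * real (card E))" .
  define r where "r = exp (\<rho> * ln (real (card \<U>)) * real (card E))"
  have "real (card I) = (\<Sum>P\<in>\<P>. real (card (words \<U> (R P))))"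
    unfolding I_def using fin\<P> finite_words[OF finite_cover finR] by simp
  also have "\<dots> \<le> (\<Sum>P\<in>\<P>. r)"
  proof (rule sum_mono)
    fix P assume "P \<in> \<P>"
    then have RP: "real (card (R P)) \<le> \<rho> * real (card E)" by (simp add: \<P>_def)
    have "real (card (words \<U> (R P))) \<le> real (card \<U> ^ card (R P))"
      using card_words_le[OF finite_cover finR] by (simp only: of_nat_le_iff)
    also have "\<dots> = exp (real (card (R P)) * ln (real (card \<U>)))"
      using U1 by (simp add: exp_of_nat_mult)
    also have "\<dots> \<le> exp (\<rho> * real (card E) * ln (real (card \<U>)))"
      using mult_right_mono[OF RP, of "ln (real (card \<U>))"] U1 by simp
    finally show "real (card (words \<U> (R P))) \<le> r"
      by (simp add: mult_ac r_def)
  qed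
  also have "\<dots> = real (card \<P>) * r" by simp
  also have "\<dots> \<le> exp (s * (real (card E) / (1 - \<epsilon>)) + real K * \<gamma> * real (card E)) * r"
    by (intro mult_right_mono families) (simp add: r_def)
  also have "\<dots> = exp ((s / (1 - \<epsilon>) + real K * \<gamma> + \<rho> * ln (real (card \<U>))) * real (card E))"
    unfolding r_def exp_add[symmetric] by (simp add: algebra_simps)
  finally have bound: "real ?N \<le> exp ((s / (1 - \<epsilon>) + real K * \<gamma> + \<rho> * ln (real (card \<U>))) * real (card E))"
    using NI by linarith
  have "?N > 0"
  proof -
    obtain V where V: "finite V" "topspace X \<subseteq> (\<Union>v\<in>V. word_set X \<phi> v)" "card V = ?N"
      by (rule cover_number_attained[OF E])
    have "V \<noteq> {}"
    proof
      assume "V = {}"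
      then show False using V(2) ne by (simp only: UN_empty subset_empty)
    qed
    then have "card V > 0" using V(1) by (simp add: card_gt_0_iff)
    then show ?thesis by (simp add: V(3))
  qed
  then have "ln (real ?N) \<le> ln (exp ((s / (1 - \<epsilon>) + real K * \<gamma> + \<rho> * ln (real (card \<U>))) * real (card E)))"
    using bound by (intro ln_mono) simp_all
  then show ?thesis by (simp only: ln_exp)
qed

section \<open>Inequalities between Bowen entropy and cover rates\<close>

text \<open>Word sets are open, so compactness extracts a finite subcover from a cover of small
  weight, and dropping words only lowers the weight. Finiteness supplies the last index
  \<open>M\<close>, beyond which a later block of indices can start.\<close>

lemma finite_cheap_cover:
  assumes F: "folner_sequence G F" and comp: "compact_space X"
    and zero: "bowen_measure X \<phi> F \<U> (topspace X) s = 0" and g: "\<gamma> > 0"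
  shows "\<exists>M \<Lambda>. N \<le> M \<and> finite \<Lambda> \<and> \<Lambda> \<subseteq> (\<Union>k\<in>{N..M}. words \<U> (F k)) \<and>
    topspace X \<subseteq> (\<Union>u\<in>\<Lambda>. word_set X \<phi> u) \<and> (\<Sum>u\<in>\<Lambda>. exp (- s * real (card (dom u)))) \<le> \<gamma>"
proof -
  let ?w = "\<lambda>u. ennreal (exp (- s * real (card (dom u))))"
  have "bowen_premeasure X \<phi> F \<U> (topspace X) s N < ennreal \<gamma>"
    using zero g by (simp add: bowen_measure_eq_0_iff)
  then obtain \<Lambda>' where L: "\<Lambda>' \<subseteq> (\<Union>j\<in>{N..}. words \<U> (F j))"
    "topspace X \<subseteq> (\<Union>u\<in>\<Lambda>'. word_set X \<phi> u)" "infsum ?w \<Lambda>' < ennreal \<gamma>"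
    unfolding bowen_premeasure_def INF_less_iff by blast
  have "openin X W" if "W \<in> word_set X \<phi> ` \<Lambda>'" for W
    using that L(1) openin_word_set folnerD(2,3)[OF F] by blast
  then obtain \<F> where "finite \<F>" "\<F> \<subseteq> word_set X \<phi> ` \<Lambda>'" "topspace X \<subseteq> \<Union>\<F>"
    using comp L(2) unfolding compact_space_alt by metis
  then obtain \<Lambda> where Lam: "\<Lambda> \<subseteq> \<Lambda>'" "finite \<Lambda>" "topspace X \<subseteq> (\<Union>u\<in>\<Lambda>. word_set X \<phi> u)"
    by (metis finite_subset_image)
  have "sum ?w \<Lambda> \<le> infsum ?w \<Lambda>'"
    unfolding nonneg_infsum_complete[of \<Lambda>' ?w, OF zero_le] by (rule SUP_upper) (use Lam in auto)
  then have "ennreal (\<Sum>u\<in>\<Lambda>. exp (- s * real (card (dom u)))) \<le> ennreal \<gamma>"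
    using L(3) by (simp add: sum_ennreal order.strict_implies_order order.trans)
  then have le: "(\<Sum>u\<in>\<Lambda>. exp (- s * real (card (dom u)))) \<le> \<gamma>" using g by (simp add: ennreal_le_iff)
  have "\<forall>u\<in>\<Lambda>. \<exists>k. N \<le> k \<and> u \<in> words \<U> (F k)" using Lam(1) L(1) by fastforce
  then obtain k where k: "\<And>u. u \<in> \<Lambda> \<Longrightarrow> N \<le> k u \<and> u \<in> words \<U> (F (k u))" by metis
  define M where "M = Max (insert N (k ` \<Lambda>))"
  have "N \<le> M" "\<And>u. u \<in> \<Lambda> \<Longrightarrow> k u \<le> M" using Lam(2) by (auto simp: M_def)
  with k Lam le show ?thesis by (intro exI[of _ M] exI[of _ \<Lambda>]) fastforce
qed

text \<open>A minimal subcover of level \<open>n\<close> has weight at most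
  \<open>exp (- (s - s') * card (F n))\<close> when its rate is at most \<open>s'\<close>. This
  tends to 0 because the Folner sets grow, and infinitely many such \<open>n\<close> supply
  competitors for every \<open>N\<close>.\<close>

lemma bowen_measure_eq_0I:
  assumes F: "folner_sequence G F" and inf: "infinite (carrier G)"
    and s: "s' < s" and freq: "\<exists>\<^sub>F n in sequentially. cover_rate X \<phi> \<U> (F n) \<le> s'"
  shows "bowen_measure X \<phi> F \<U> (topspace X) s = 0"
  unfolding bowen_measure_eq_0_iff
proof
  fix N
  let ?w = "\<lambda>u. ennreal (exp (- s * real (card (dom u))))"
  have "bowen_premeasure X \<phi> F \<U> (topspace X) s N \<le> 0 + ennreal \<gamma>" if g: "\<gamma> > 0" for \<gamma>
  proof -
    have "filterlim (\<lambda>n. (s - s') * real (card (F n))) at_top sequentially"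
      using s folner_card_at_top[OF F inf]
      by (intro filterlim_tendsto_pos_mult_at_top[OF tendsto_const] filterlim_compose[OF filterlim_real_sequentially]) auto
    then have "\<forall>\<^sub>F n in sequentially. (s - s') * real (card (F n)) \<ge> - ln \<gamma>"
      by (simp add: filterlim_at_top)
    then have "\<exists>\<^sub>F n in sequentially. cover_rate X \<phi> \<U> (F n) \<le> s' \<and> ((s - s') * real (card (F n)) \<ge> - ln \<gamma> \<and> n \<ge> N)"
      using freq eventually_ge_at_top[of N]
      by (intro frequently_eventually_frequently eventually_conj)
    then obtain n where n: "cover_rate X \<phi> \<U> (F n) \<le> s'" "(s - s') * real (card (F n)) \<ge> - ln \<gamma>" "n \<ge> N"
      using frequently_ex by blast
    obtain V where V: "finite V" "V \<subseteq> words \<U> (F n)" "topspace X \<subseteq> (\<Union>v\<in>V. word_set X \<phi> v)"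
      "card V = cover_number X (iterated_cover X \<phi> \<U> (F n))"
      by (rule cover_number_attained[OF folnerD(2,3)[OF F]])
    have "real (card V) \<le> exp (s' * real (card (F n)))"
    proof (cases "card V = 0")
      case False
      have "ln (real (card V)) \<le> s' * real (card (F n))"
        using n(1) folnerD(4)[OF F, of n] by (simp add: V(4) pos_divide_le_eq)
      then have "exp (ln (real (card V))) \<le> exp (s' * real (card (F n)))" by simp
      then show ?thesis using False by simp
    qed simp
    then have "real (card V) * exp (- s * real (card (F n))) \<le> exp (s' * real (card (F n))) * exp (- s * real (card (F n)))"
      by (intro mult_right_mono) auto
    also have "\<dots> = exp (- ((s - s') * real (card (F n))))"
      by (simp add: exp_add[symmetric] algebra_simps)
    also have "\<dots> \<le> exp (ln \<gamma>)" using n(2) by (subst exp_le_cancel_iff) linarith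
    finally have le: "real (card V) * exp (- s * real (card (F n))) \<le> \<gamma>" using g by simp
    have "bowen_premeasure X \<phi> F \<U> (topspace X) s N \<le> infsum ?w V"
      unfolding bowen_premeasure_def by (rule INF_lower) (use V n(3) in auto)
    also have "\<dots> = (\<Sum>u\<in>V. ?w u)" using V(1) by simp
    also have "\<dots> = ennreal (\<Sum>u\<in>V. exp (- s * real (card (dom u))))" by simp
    also have "(\<Sum>u\<in>V. exp (- s * real (card (dom u)))) = (\<Sum>u\<in>V. exp (- s * real (card (F n))))"
      using V(2) by (intro sum.cong refl) (auto simp: words_def)
    also have "ennreal \<dots> \<le> ennreal \<gamma>" using le by (intro ennreal_leI) simp
    finally show ?thesis by simp
  qed
  then have "bowen_premeasure X \<phi> F \<U> (topspace X) s N \<le> 0"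
    by (rule ennreal_le_epsilon)
  then show "bowen_premeasure X \<phi> F \<U> (topspace X) s N = 0" by simp
qed

text \<open>The summand 1 in the upper bound avoids treating separately the empty cover of an empty
  space.\<close>

lemma cover_rate_bounds:
  assumes "finite E" "E \<subseteq> carrier G" "card E > 0"
  shows "0 \<le> cover_rate X \<phi> \<U> E" "cover_rate X \<phi> \<U> E \<le> ln (real (card \<U> + 1))"
proof -
  let ?N = "cover_number X (iterated_cover X \<phi> \<U> E)"
  show "0 \<le> cover_rate X \<phi> \<U> E" by (cases "?N = 0") auto
  have "?N \<le> card \<U> ^ card E" using cover_number_le_power[OF assms(1,2)] .
  also have "\<dots> \<le> (card \<U> + 1) ^ card E" by (simp add: power_mono)
  finally have "real ?N \<le> real ((card \<U> + 1) ^ card E)" by (simp only: of_nat_le_iff)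
  then have le: "real ?N \<le> real (card \<U> + 1) ^ card E" by simp
  have "ln (real ?N) \<le> real (card E) * ln (real (card \<U> + 1))"
  proof (cases "?N = 0")
    case False
    then have "ln (real ?N) \<le> ln (real (card \<U> + 1) ^ card E)" using le by (intro ln_mono) auto
    then show ?thesis by (simp add: ln_realpow)
  qed simp
  then show "cover_rate X \<phi> \<U> E \<le> ln (real (card \<U> + 1))"
    using assms(3) by (simp add: pos_divide_le_eq mult.commute)
qed

text \<open>The gap \<open>t = s' - s\<close> is split into four quarters: for the overlap of tiles
  (\<epsilon>), the geometric decay (\<open>K\<close>), the boundary losses (\<delta>) and the
  weight of the families (\<gamma>). The number \<open>K\<close> has to be fixed before \<gamma>,
  which is summed over \<open>K\<close> levels. Then \<open>K\<close> successive blocks of indices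
  are built, and \<open>E n\<close> is eventually invariant under all of them.\<close>

lemma eventually_cover_rate_le:
  assumes F: "folner_sequence G F" "tempered G F" and comp: "compact_space X"
    and zero: "bowen_measure X \<phi> F \<U> (topspace X) s = 0" and s: "0 \<le> s" "s < s'"
    and E: "folner_sequence G E"
  shows "\<forall>\<^sub>F n in sequentially. cover_rate X \<phi> \<U> (E n) \<le> s'"
proof (cases "topspace X = {}")
  case True
  have "cover_number X (iterated_cover X \<phi> \<U> (E n)) \<le> card ({} :: ('a \<rightharpoonup> 'x set) set)" for n
    using True by (intro cover_number_le_card) auto
  then show ?thesis using s by simp
next
  case False
  obtain C where C: "C > 0"
    "\<And>n. real (card (\<Union>k<n. set_inv (F k) <#> F n)) \<le> C * real (card (F n))"
    using F(2) by (auto simp: tempered_def)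
  define t where "t = s' - s"
  have t: "t > 0" using s by (simp add: t_def)
  have U1: "real (card \<U>) \<ge> 1"
  proof -
    have "\<U> \<noteq> {}" using False cov unfolding finite_open_cover_def by (metis Union_empty)
    then have "card \<U> > 0" using finite_cover by (simp add: card_gt_0_iff)
    then show ?thesis by simp
  qed
  define w where "w = ln (real (card \<U>))"
  have w: "w \<ge> 0" using U1 by (simp add: w_def)
  define \<epsilon> where "\<epsilon> = min (1 / 2) (t / (8 * (s + 1)))"
  have "\<epsilon> \<le> 1 / 2" unfolding \<epsilon>_def by (rule min.cobounded1)
  moreover have "0 < \<epsilon>" using t s by (simp add: \<epsilon>_def)
  ultimately have e: "0 < \<epsilon>" "\<epsilon> < 1" "\<epsilon> \<le> 1 / 2" by auto
  have es: "s / (1 - \<epsilon>) \<le> s + t / 4"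
  proof -
    have "\<epsilon> \<le> t / (8 * (s + 1))" unfolding \<epsilon>_def by (rule min.cobounded2)
    then have "\<epsilon> * (8 * (s + 1)) \<le> t" using s by (simp add: pos_le_divide_eq)
    then have "8 * (s * \<epsilon>) \<le> t" using e by (simp add: algebra_simps)
    moreover have "t * \<epsilon> \<le> t * (1 / 2)" using t e by (intro mult_left_mono) auto
    ultimately have "s \<le> (s + t / 4) * (1 - \<epsilon>)" by (simp add: algebra_simps)
    then show ?thesis using e by (simp add: pos_divide_le_eq)
  qed
  define \<eta> where "\<eta> = 1 / (C / (1 - \<epsilon>) + 1 / \<epsilon>)"
  have "C / (1 - \<epsilon>) > 0" "1 / \<epsilon> > 1" using C e by auto
  then have eta: "0 < \<eta>" "\<eta> < 1" by (auto simp: \<eta>_def)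
  obtain K where K: "(1 - \<eta>) ^ K < t / (4 * (w + 1))"
    using real_arch_pow_inv[of "t / (4 * (w + 1))" "1 - \<eta>"] eta t w by auto
  \<comment> \<open>As \<open>\<epsilon> \<le> 1 / 2\<close>, the sum
    \<open>\<delta> + \<delta> / (1 - \<epsilon>)\<close> is at most \<open>3 * \<delta>\<close>, so
    12 leaves a quarter of \<open>t\<close>.\<close>
  define \<delta> where "\<delta> = t / (12 * (w + 1))"
  have d: "\<delta> > 0" using t w by (simp add: \<delta>_def)
  define \<gamma> where "\<gamma> = t / (4 * (real K + 1))"
  have g: "\<gamma> > 0" using t by (simp add: \<gamma>_def)
  define \<rho> where "\<rho> = (1 - \<eta>) ^ K + (\<delta> + \<delta> / (1 - \<epsilon>))"
  have total: "s / (1 - \<epsilon>) + real K * \<gamma> + \<rho> * w \<le> s'"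
  proof -
    have "real K * \<gamma> \<le> t / 4" using t by (simp add: \<gamma>_def field_simps)
    moreover have "(1 - \<eta>) ^ K * w \<le> t / 4"
    proof -
      have "(1 - \<eta>) ^ K * (w + 1) \<le> t / 4" using K w by (simp add: pos_less_divide_eq algebra_simps)
      moreover have "(1 - \<eta>) ^ K \<ge> 0" using eta by simp
      ultimately show ?thesis by (simp add: algebra_simps)
    qed
    moreover have "(\<delta> + \<delta> / (1 - \<epsilon>)) * w \<le> t / 4"
    proof -
      have "\<delta> / (1 - \<epsilon>) \<le> \<delta> * 2" using d e by (simp add: pos_divide_le_eq)
      then have "(\<delta> + \<delta> / (1 - \<epsilon>)) * w \<le> (3 * \<delta>) * (w + 1)" using w d by (intro mult_mono) auto
      also have "\<dots> = t / 4" using w by (simp add: \<delta>_def field_simps)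
      finally show ?thesis .
    qed
    moreover have "\<rho> * w = (1 - \<eta>) ^ K * w + (\<delta> + \<delta> / (1 - \<epsilon>)) * w"
      unfolding \<rho>_def by (rule distrib_right)
    ultimately show ?thesis using es t_def by linarith
  qed
  have "\<forall>N. \<exists>p. N \<le> fst p \<and> finite (snd p) \<and> snd p \<subseteq> (\<Union>k\<in>{N..fst p}. words \<U> (F k)) \<and>
      topspace X \<subseteq> (\<Union>u\<in>snd p. word_set X \<phi> u) \<and> (\<Sum>u\<in>snd p. exp (- s * real (card (dom u)))) \<le> \<gamma>"
    using finite_cheap_cover[OF F(1) comp zero g] by simp
  then obtain p where p: "\<And>N. N \<le> fst (p N)" "\<And>N. finite (snd (p N))"
      "\<And>N. snd (p N) \<subseteq> (\<Union>k\<in>{N..fst (p N)}. words \<U> (F k))"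
      "\<And>N. topspace X \<subseteq> (\<Union>u\<in>snd (p N). word_set X \<phi> u)"
      "\<And>N. (\<Sum>u\<in>snd (p N). exp (- s * real (card (dom u)))) \<le> \<gamma>"
    unfolding choice_iff by blast
  define I where "I M = (\<Union>k\<le>M. F k)" for M
  have I: "finite (I M)" "I M \<subseteq> carrier G" for M
    using folnerD(2,3)[OF F(1)] by (auto simp: I_def)
  then have I': "finite (set_inv (I M))" "set_inv (I M) \<subseteq> carrier G" for M
    by (auto simp: SET_INV_def)
  have "\<exists>b>M. \<forall>m\<ge>b. real (card ((set_inv (I M) <#> F m) - F m)) \<le> \<delta> * real (card (F m))" for M
  proof -
    obtain n where n: "\<And>m. n \<le> m \<Longrightarrow> real (card ((set_inv (I M) <#> F m) - F m)) \<le> \<delta> * real (card (F m))"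
      using folner_eventually_set_mult[OF F(1) I' d, of M] unfolding eventually_sequentially by blast
    show ?thesis by (rule exI[of _ "max n (Suc M)"]) (use n in auto)
  qed
  then obtain b where b: "\<And>M. M < b M"
      "\<And>M m. b M \<le> m \<Longrightarrow> real (card ((set_inv (I M) <#> F m) - F m)) \<le> \<delta> * real (card (F m))"
    by metis
  \<comment> \<open>Block \<open>i\<close> starts at \<open>N i\<close> and ends with the last index
    allowed in its finite cover. The next block starts where the sets \<open>F m\<close> have become
    invariant under the inverses of all sets up to that index.\<close>
  define N where "N i = ((\<lambda>m. b (fst (p m))) ^^ i) 0" for i
  have N_Suc: "N (Suc i) = b (fst (p (N i)))" for i by (simp add: N_def)
  have "N i \<le> N (Suc i)" for i
    unfolding N_Suc using p(1)[of "N i"] b(1)[of "fst (p (N i))"] by linarith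
  then have N_mono: "i \<le> i' \<Longrightarrow> N i \<le> N i'" for i i' by (rule lift_Suc_mono_le)
  define J where "J i = {N i..fst (p (N i))}" for i
  have JI: "(\<Union>k\<in>J i. F k) \<subseteq> I (fst (p (N i)))" for i by (auto simp: J_def I_def)
  have inv: "real (card ((set_inv (\<Union>k\<in>J i. F k) <#> F m) - F m)) \<le> \<delta> * real (card (F m))"
    if "i < i'" "m \<in> J i'" for i i' m
  proof -
    have "b (fst (p (N i))) \<le> m" using N_mono[of "Suc i" i'] that by (auto simp: J_def N_Suc)
    note b(2)[OF this]
    moreover have "(set_inv (\<Union>k\<in>J i. F k) <#> F m) - F m \<subseteq> (set_inv (I (fst (p (N i)))) <#> F m) - F m"
      using JI[of i] unfolding set_mult_def SET_INV_def by blast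
    then have "card ((set_inv (\<Union>k\<in>J i. F k) <#> F m) - F m) \<le> card ((set_inv (I (fst (p (N i)))) <#> F m) - F m)"
      using I'(1) folnerD(2)[OF F(1)] by (intro card_mono) (auto simp: finite_set_mult)
    ultimately show ?thesis by linarith
  qed
  have "\<forall>\<^sub>F n in sequentially. \<forall>i\<in>{..<K}.
      real (card {c \<in> E n. \<not> (\<Union>k\<in>J i. F k) #> c \<subseteq> E n}) \<le> \<delta> * real (card (E n))"
  proof (intro eventually_ball_finite ballI folner_eventually_core[OF E _ _ d])
    fix i
    show "finite (\<Union>k\<in>J i. F k)" "(\<Union>k\<in>J i. F k) \<subseteq> carrier G"
      using JI[of i] I[of "fst (p (N i))"] finite_subset by auto
  qed simp
  then show ?thesis
  proof (rule eventually_mono)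
    fix n
    assume core: "\<forall>i\<in>{..<K}. real (card {c \<in> E n. \<not> (\<Union>k\<in>J i. F k) #> c \<subseteq> E n}) \<le> \<delta> * real (card (E n))"
    have "ln (real (cover_number X (iterated_cover X \<phi> \<U> (E n))))
        \<le> (s / (1 - \<epsilon>) + real K * \<gamma> + \<rho> * ln (real (card \<U>))) * real (card (E n))"
    proof (rule ln_cover_number_le_tiling[OF folnerD(2,1,3)[OF F(1)] C(2), where J = J and \<Lambda> = "\<lambda>i. snd (p (N i))"])
      show "0 \<le> C" using C by simp
      show "0 < \<epsilon>" "\<epsilon> < 1" "0 \<le> \<delta>" using e d by auto
      show "finite (E n)" "E n \<subseteq> carrier G" using folnerD[OF E] by auto
      show "finite (J i)" for i by (simp add: J_def)
      show "real (card ((set_inv (\<Union>k\<in>J i. F k) <#> F m) - F m)) \<le> \<delta> * real (card (F m))"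
        if "i < i'" "i' < K" "m \<in> J i'" for i i' m using inv that by blast
      show "real (card {c \<in> E n. \<not> (\<Union>k\<in>J i. F k) #> c \<subseteq> E n}) \<le> \<delta> * real (card (E n))"
        if "i < K" for i using core that by simp
      show "snd (p (N i)) \<subseteq> (\<Union>k\<in>J i. words \<U> (F k))" for i using p(3) by (simp add: J_def)
    qed (use p s False \<eta>_def \<rho>_def in auto)
    also have "\<dots> \<le> s' * real (card (E n))"
      using total by (intro mult_right_mono) (auto simp: w_def)
    finally show "cover_rate X \<phi> \<U> (E n) \<le> s'"
      using folnerD(4)[OF E, of n] by (simp add: pos_divide_le_eq)
  qed
qed

section \<open>Comparison of Folner sequences\<close>

text \<open>The cover rates mediate: a zero at \<open>s\<close> along the tempered \<open>F\<close>
  bounds the rates along \<open>E\<close>, and these in turn force a zero along \<open>E\<close>.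
  The midpoint leaves strict room for both implications.\<close>

lemma bowen_zeros_upward:
  assumes F: "folner_sequence G F" "tempered G F" and inf: "infinite (carrier G)" and comp: "compact_space X"
    and zero: "bowen_measure X \<phi> F \<U> (topspace X) s = 0" and s: "0 \<le> s" "s < s'"
    and E: "folner_sequence G E"
  shows "bowen_measure X \<phi> E \<U> (topspace X) s' = 0"
proof (rule bowen_measure_eq_0I[OF E inf])
  show "(s + s') / 2 < s'" using s by simp
  have "\<forall>\<^sub>F n in sequentially. cover_rate X \<phi> \<U> (E n) \<le> (s + s') / 2"
    using s by (intro eventually_cover_rate_le[OF F comp zero s(1) _ E]) simp
  then show "\<exists>\<^sub>F n in sequentially. cover_rate X \<phi> \<U> (E n) \<le> (s + s') / 2"
    by (intro eventually_frequently) simp_all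
qed

text \<open>The limit \<open>h\<close> is the infimum of the zeros along \<open>F\<close>, and rates
  along \<open>E\<close> are eventually below any number above \<open>h\<close>. If they were
  infinitely often at most some \<open>a < h\<close>, a tempered subsequence of those indices would
  have a zero below \<open>h\<close>, which transfers back to \<open>F\<close>.\<close>

lemma cover_rate_tendsto_bowen_entropy:
  assumes F: "folner_sequence G F" "tempered G F" and inf: "infinite (carrier G)" and comp: "compact_space X"
  obtains h where "bowen_entropy_cover X \<phi> F \<U> (topspace X) = ereal h"
    "\<And>E. folner_sequence G E \<Longrightarrow> (\<lambda>n. cover_rate X \<phi> \<U> (E n)) \<longlonglongrightarrow> h"
proof -
  define Z where "Z = {s. 0 \<le> s \<and> bowen_measure X \<phi> F \<U> (topspace X) s = 0}"
  define h where "h = Inf Z"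
  \<comment> \<open>The uniform bound on the rates supplies a zero, so \<open>h\<close> is
    finite.\<close>
  have "ln (real (card \<U> + 1)) + 1 \<in> Z"
    unfolding Z_def
  proof (intro CollectI conjI)
    show "bowen_measure X \<phi> F \<U> (topspace X) (ln (real (card \<U> + 1)) + 1) = 0"
      by (rule bowen_measure_eq_0I[OF F(1) inf, of "ln (real (card \<U> + 1))"])
        (use cover_rate_bounds(2)[OF folnerD(2,3,4)[OF F(1)]] in \<open>auto intro!: eventually_frequently always_eventually\<close>)
  qed simp
  then have ne: "Z \<noteq> {}" by blast
  have bdd: "bdd_below Z" by (auto simp: Z_def)
  have h0: "0 \<le> h" unfolding h_def using ne by (intro cInf_greatest) (auto simp: Z_def)
  have "bowen_entropy_cover X \<phi> F \<U> (topspace X) = Inf (ereal ` Z)"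
    by (simp add: bowen_entropy_cover_def Z_def image_Collect)
  also have "\<dots> = ereal h"
    unfolding h_def using ereal_Inf'[OF bdd ne] by simp
  finally have eq: "bowen_entropy_cover X \<phi> F \<U> (topspace X) = ereal h" .
  have "(\<lambda>n. cover_rate X \<phi> \<U> (E n)) \<longlonglongrightarrow> h" if E: "folner_sequence G E" for E
  proof (rule order_tendstoI)
    fix a assume "h < a"
    then obtain s where s: "s \<in> Z" "s < a" using cInf_lessD[OF ne] by (auto simp: h_def)
    have "\<forall>\<^sub>F n in sequentially. cover_rate X \<phi> \<U> (E n) \<le> (s + a) / 2"
      using s by (intro eventually_cover_rate_le[OF F comp _ _ _ E, of s]) (auto simp: Z_def)
    then show "\<forall>\<^sub>F n in sequentially. cover_rate X \<phi> \<U> (E n) < a"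
      by (rule eventually_mono) (use s(2) in \<open>simp add: field_simps\<close>)
  next
    fix a assume a: "a < h"
    show "\<forall>\<^sub>F n in sequentially. a < cover_rate X \<phi> \<U> (E n)"
    proof (rule ccontr)
      assume "\<not> (\<forall>\<^sub>F n in sequentially. a < cover_rate X \<phi> \<U> (E n))"
      then have "\<exists>\<^sub>F n in sequentially. cover_rate X \<phi> \<U> (E n) \<le> a"
        by (simp add: not_eventually not_less)
      then have "infinite {n. cover_rate X \<phi> \<U> (E n) \<le> a}"
        by (simp add: frequently_cofinite flip: cofinite_eq_sequentially)
      then obtain r :: "nat \<Rightarrow> nat" where r: "strict_mono r" "\<And>n. cover_rate X \<phi> \<U> (E (r n)) \<le> a"
        using infinite_enumerate by blast
      have Er: "folner_sequence G (E \<circ> r)" by (rule folner_subseq[OF E r(1)])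
      obtain q where q: "strict_mono q" "tempered G ((E \<circ> r) \<circ> q)"
        using folner_tempered_subseq[OF Er] by blast
      have Eq: "folner_sequence G ((E \<circ> r) \<circ> q)" by (rule folner_subseq[OF Er q(1)])
      have a0: "0 \<le> a" using r(2)[of 0] cover_rate_bounds(1)[OF folnerD(2,3,4)[OF E], of "r 0"] by linarith
      \<comment> \<open>Two points strictly between \<open>a\<close> and \<open>h\<close>: one
        increase produces the zero along the subsequence, the other carries it over to
        \<open>F\<close>.\<close>
      define s s' where "s = a + (h - a) / 3" and "s' = a + 2 * (h - a) / 3"
      have ss: "a < s" "s < s'" "s' < h" "0 \<le> s" "0 \<le> s'" using a a0 by (auto simp: s_def s'_def field_simps)
      have "bowen_measure X \<phi> ((E \<circ> r) \<circ> q) \<U> (topspace X) s = 0"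
        by (rule bowen_measure_eq_0I[OF Eq inf ss(1)])
          (use r(2) in \<open>auto intro!: eventually_frequently always_eventually\<close>)
      then have "bowen_measure X \<phi> F \<U> (topspace X) s' = 0"
        by (rule bowen_zeros_upward[OF Eq q(2) inf comp _ ss(4,2) F(1)])
      then have "s' \<in> Z" using ss by (simp add: Z_def)
      then have "h \<le> s'" unfolding h_def by (rule cInf_lower[OF _ bdd])
      then show False using ss by simp
    qed
  qed
  with eq show ?thesis using that by blast
qed

end

end

theorem theorem1p1:
  fixes G :: "('g, 'm) monoid_scheme"
    and X :: "'x topology"
    and \<phi> :: "'g \<Rightarrow> 'x \<Rightarrow> 'x"
    and F :: "nat \<Rightarrow> 'g set"
  assumes "group G" and "countable (carrier G)" and "infinite (carrier G)" and "amenable G"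
    and "compact_space X" and "Hausdorff_space X"
    and "acts_by_homeomorphisms G X \<phi>"
    and "folner_sequence G F" and "tempered G F"
  shows "bowen_entropy X \<phi> F (topspace X) = top_entropy G X \<phi>"
proof -
  interpret group G by fact
  have "bowen_entropy_cover X \<phi> F \<U> (topspace X) = ereal (top_entropy_cover G X \<phi> \<U>)"
    if cov: "finite_open_cover X \<U>" for \<U>
  proof -
    obtain h where h: "bowen_entropy_cover X \<phi> F \<U> (topspace X) = ereal h"
      "\<And>E. folner_sequence G E \<Longrightarrow>
        (\<lambda>n. ln (real (cover_number X (iterated_cover X \<phi> \<U> (E n)))) / real (card (E n))) \<longlonglongrightarrow> h"
      using cover_rate_tendsto_bowen_entropy[OF assms(7) cov assms(8,9,3,5)] by blast
    \<comment> \<open>Convergence along every Folner sequence makes \<open>h\<close> a witness for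
      the definite description; limits along \<open>F\<close> alone make it unique.\<close>
    have "top_entropy_cover G X \<phi> \<U> = h"
      unfolding top_entropy_cover_def
    proof (rule the_equality)
      fix h'
      assume "\<forall>F. folner_sequence G F \<longrightarrow>
        (\<lambda>n. ln (real (cover_number X (iterated_cover X \<phi> \<U> (F n)))) / real (card (F n))) \<longlonglongrightarrow> h'"
      then show "h' = h" using h(2)[OF assms(8)] assms(8) LIMSEQ_unique by blast
    qed (use h(2) in blast)
    with h(1) show ?thesis by simp
  qed
  then show ?thesis unfolding bowen_entropy_def top_entropy_def by (intro SUP_cong) auto
qed

end
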